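(* Let $q\ge1$ be an integer and let $a$ be an integer prime to $q$. Let $F$ and $G$ be two polynomials of $\mathbb{C}[t]$. Assume that $G(0)=1$ and that $F(0)=F'(0)=0$. Let $\beta\ge2$ be larger than $1/|\rho|$ for every root $\rho$ of $G$ and every root $\rho$ of $G-F$. Let $P\ge2\beta$ be an integer parameter. Then, for any integer parameter $L\ge2$, we have $$\prod_{\substack{p\ge P\\ p\equiv a\,[q]}}\left(1-\frac{F(1/p)}{G(1/p)}\right)=\exp\left(\sum_{2\le j\le J}\bigl(b_{G-F}(j)-b_G(j)\bigr)\,Y_P(j;q,a|L)+I\right)$$ with $J=2L$, where the integers $b_{G-F}(j)$ and $b_G(j)$ and the quantity $Y_P(j;q,a|L)$ are as defined in the context, and where $$|I|\le 8\max\bigl(\deg(G-F),\deg G\bigr)\,\beta^2\,(\beta/P)^{2L}.$$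
   Context: The letter $p$ denotes primes; $p\equiv a\,[q]$ means $p\equiv a\pmod q$; $\varphi$ is Euler's function and $\mu$ the Möbius function. For a polynomial $H(t)\in\mathbb{C}[t]$ of degree $\delta$ with $H(0)=1$, let $\alpha_1,\dots,\alpha_\delta$ be the inverses of its roots (with multiplicity), put $s_H(k)=\alpha_1^k+\cdots+\alpha_\delta^k$ for $k\ge1$, and define $$b_H(k)=\frac1k\sum_{d\mid k}\mu(k/d)\,s_H(d).$$ Let $\widehat{G}_q$ be the group of Dirichlet characters modulo $q$. For $\chi\in\widehat{G}_q$ and $\Re s>1$ put $L_P(s,\chi)=\prod_{p\ge P}(1-\chi(p)/p^s)^{-1}$, with logarithm $\log L_P(s,\chi)=\sum_{p\ge P}\sum_{k\ge1}\frac{\chi(p)^k}{k\,p^{ks}}$. With $\chi^d$ the $d$-th power of $\chi$ in $\widehat{G}_q$ (a character modulo $q$), define $$Y_P(s;q,a|L)=\sum_{1\le\ell\le L}\frac1\ell\sum_{d\mid\ell}\mu(d)\sum_{\chi\in\widehat{G}_q}\frac{\overline{\chi}(a)}{\varphi(q)}\log L_P(\ell s,\chi^d).$$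
   Formalization: The sum over j in the exponential carries a minus sign; the printed plus sign is false with the given definitions (e.g. q=a=1, G=1, F=t², β=2, P=37, L=2). The b's are complex numbers, not assumed to be integers. *)

theory Defs
  imports "HOL-Analysis.Analysis" "HOL-Number_Theory.Number_Theory"
    "HOL-Computational_Algebra.Computational_Algebra"
begin

definition moebius :: "nat \<Rightarrow> int" where
  "moebius n = (if squarefree n then (- 1) ^ card (prime_factors n) else 0)"

text \<open>If \<open>H 0 \<noteq> 0\<close>, no root of \<open>H\<close> vanishes and the multiset \<open>proots H\<close> counts roots with
  multiplicity.  For complex coefficients \<open>wcoeff H k\<close> need not be an integer, so it is
  complex-valued.\<close>

definition inv_root_power_sum :: "complex poly \<Rightarrow> nat \<Rightarrow> complex" where
  "inv_root_power_sum H k = (\<Sum>\<rho>\<in>#proots H. inverse \<rho> ^ k)"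

definition wcoeff :: "complex poly \<Rightarrow> nat \<Rightarrow> complex" where
  "wcoeff H k =
     1 / of_nat k * (\<Sum>d | d dvd k. of_int (moebius (k div d)) * inv_root_power_sum H d)"

text \<open>Multiplicativity and nonvanishing on units force the value 1 at 1.\<close>

definition dirichlet_characters :: "nat \<Rightarrow> (int \<Rightarrow> complex) set" where
  "dirichlet_characters q =
     {\<psi>. (\<forall>m n. \<psi> (m * n) = \<psi> m * \<psi> n) \<and> (\<forall>n. \<psi> (n + int q) = \<psi> n) \<and>
         (\<forall>n. \<psi> n \<noteq> 0 \<longleftrightarrow> coprime n (int q))}"

text \<open>In the character group the \<open>d\<close>-th power is pointwise as long as \<open>d \<ge> 1\<close>, which is the only
  case used below.\<close>

lemma dirichlet_characters_power:
  "\<psi> \<in> dirichlet_characters q \<Longrightarrow> d \<ge> 1 \<Longrightarrow> (\<lambda>n. \<psi> n ^ d) \<in> dirichlet_characters q"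
  by (auto simp: dirichlet_characters_def power_mult_distrib)

text \<open>The logarithm of \<open>\<Prod>p\<ge>P. 1 / (1 - \<psi> p / p powr s)\<close> for \<open>Re s > 1\<close>, as the double series
  (and not as the principal branch \<open>Ln\<close>).\<close>

definition log_L :: "nat \<Rightarrow> complex \<Rightarrow> (int \<Rightarrow> complex) \<Rightarrow> complex" where
  "log_L P s \<psi> =
     (\<Sum>\<^sub>\<infinity>p\<in>{p. prime p \<and> P \<le> p}. \<Sum>\<^sub>\<infinity>k\<in>{1..}.
        \<psi> (int p) ^ k / (of_nat k * of_nat p powr (of_nat k * s)))"

text \<open>As \<open>L\<close> grows, \<open>Y_sum P (of_nat j) q a L\<close> tends to the sum of \<open>- ln (1 - 1 / p ^ j)\<close> over the
  primes \<open>p \<ge> P\<close> with \<open>p\<close> congruent to \<open>a\<close> modulo \<open>q\<close>, while formally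
  \<open>H t = (\<Prod>k\<ge>1. (1 - t ^ k) powr wcoeff H k)\<close>.  Hence \<open>Y_sum\<close> enters the logarithm of a product of
  values of \<open>H\<close> with coefficient \<open>- wcoeff H j\<close>.\<close>

definition Y_sum :: "nat \<Rightarrow> complex \<Rightarrow> nat \<Rightarrow> int \<Rightarrow> nat \<Rightarrow> complex" where
  "Y_sum P s q a L =
     (\<Sum>l = 1..L. 1 / of_nat l * (\<Sum>d | d dvd l. of_int (moebius d) *
        (\<Sum>\<psi>\<in>dirichlet_characters q. cnj (\<psi> a) / of_nat (totient q) *
            log_L P (of_nat l * s) (\<lambda>n. \<psi> n ^ d))))"

end

theory Submission
  imports Defs
begin

text \<open>
  Write \<open>x = 1 / p\<close>.  For a polynomial \<open>H\<close> with \<open>H 0 = 1\<close>, the factorization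
  \<open>H t = (\<Prod>\<alpha>. 1 - \<alpha> t)\<close> over the inverse roots gives
  \<open>H t = exp (- (\<Sum>n\<ge>1. s\<^sub>H n * t ^ n / n))\<close>, and Moebius inversion turns the definition of
  \<open>b\<^sub>H\<close> into \<open>s\<^sub>H n = (\<Sum>d | d dvd n. d * b\<^sub>H d)\<close>.  Taking \<open>H = G - F\<close> and \<open>H = G\<close>, the
  factor \<open>1 - F x / G x\<close> is the exponential of a power series in \<open>x\<close> whose \<open>n\<close>-th coefficient is
  \<open>- (\<Sum>d | d dvd n. d * \<Delta> d) / n\<close>, where \<open>\<Delta> = b\<^sub>G\<^sub>-\<^sub>F - b\<^sub>G\<close>.  The hypothesis
  \<open>F 0 = F' 0 = 0\<close> makes \<open>G - F\<close> and \<open>G\<close> agree up to the linear term, so \<open>\<Delta> 1 = 0\<close>.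

  On the other side, orthogonality of Dirichlet characters collapses the character sum in
  \<open>Y\<^sub>P(j; q, a | L)\<close> to the indicator of \<open>p ^ (d * k) \<equiv> a\<close>.  Hence \<open>Y\<^sub>P(j; q, a | L)\<close> is a sum over
  the primes \<open>p \<ge> P\<close> of power series in \<open>x ^ j\<close> (\<open>has_sum_Y_sum\<close>).  By
  \<open>(\<Sum>d | d dvd n. \<mu> d) = 0\<close> for \<open>n > 1\<close>, the coefficient of \<open>x ^ (j * m)\<close> equals that of
  \<open>- ln (1 - x ^ j)\<close> (times the indicator of \<open>p \<equiv> a\<close>) as long as \<open>m \<le> L\<close>, and it is at most \<open>m\<close>
  in absolute value otherwise (\<open>truncated_coeff_eq\<close>, \<open>norm_truncated_coeff_le\<close>).

  The two power series are now compared prime by prime (\<open>norm_truncation_error_le\<close>).  Only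
  \<open>j \<ge> 2\<close> occurs, so for \<open>n \<le> 2 * L\<close> every \<open>n = j * m\<close> has \<open>m \<le> L\<close>, and the coefficients
  of \<open>x ^ n\<close> in \<open>log (1 - F x / G x)\<close> (times the same indicator) and in \<open>- (\<Sum>j. \<Delta> j * Y j)\<close> agree.  For \<open>n > 2 * L\<close> their
  difference is at most \<open>6 * D * \<beta> ^ n\<close> with \<open>D = max (deg (G - F)) (deg G)\<close>, and as
  \<open>\<beta> * x \<le> 1 / 2\<close> the tail contributes at most \<open>12 * D * (\<beta> / p) ^ (2 * L + 1)\<close>.  Summing over
  \<open>p \<ge> P\<close> with \<open>(\<Sum>n\<ge>P. 1 / n ^ 2) \<le> 1 / (P - 1) \<le> 4 / (3 * P)\<close> gives
  \<open>16 * D * \<beta> * (\<beta> / P) ^ (2 * L)\<close>, and \<open>2 * \<beta> \<le> \<beta> ^ 2\<close>.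
\<close>

section \<open>Extending characters of subgroups of the units modulo \<open>q\<close>\<close>

lemma euler_theorem_int:
  fixes m :: int and q :: nat
  assumes "q \<ge> 1" "coprime m (int q)"
  shows "[m ^ totient q = 1] (mod int q)"
proof -
  define r where "r = nat (m mod int q)"
  have r: "int r = m mod int q" using assms(1) by (simp add: r_def)
  have rm: "[int r = m] (mod int q)" by (simp add: r cong_def)
  have "coprime (int r) (int q)"
    using assms cong_imp_coprime[OF cong_sym[OF rm]] by simp
  hence "[r ^ totient q = 1] (mod q)" by (intro euler_theorem) simp
  hence "[int r ^ totient q = 1] (mod int q)" by (metis cong_int_iff of_nat_1 of_nat_power)
  thus ?thesis using cong_pow[OF rm, of "totient q"] by (metis cong_sym cong_trans)
qed

definition reduced_residues :: "nat \<Rightarrow> int set" where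
  "reduced_residues q = {n \<in> {0..<int q}. coprime n (int q)}"

lemma finite_reduced_residues [simp]: "finite (reduced_residues q)"
  by (rule finite_subset[of _ "{0..<int q}"]) (auto simp: reduced_residues_def)

lemma card_reduced_residues:
  assumes "q \<ge> 1"
  shows "card (reduced_residues q) = totient q"
proof (cases "q = 1")
  case True
  have "reduced_residues 1 = {0}" by (auto simp: reduced_residues_def)
  thus ?thesis using True by simp
next
  case False
  hence q: "q > 1" using assms by simp
  have "reduced_residues q = int ` totatives q"
  proof (intro equalityI subsetI)
    fix n assume n: "n \<in> reduced_residues q"
    hence "n \<noteq> 0" using q by (auto simp: reduced_residues_def)
    hence "nat n \<in> totatives q" "n = int (nat n)"
      using n by (auto simp: reduced_residues_def in_totatives_iff simp flip: coprime_int_iff)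
    thus "n \<in> int ` totatives q" by blast
  next
    fix n assume "n \<in> int ` totatives q"
    thus "n \<in> reduced_residues q"
      using totatives_less[OF _ q] by (auto simp: reduced_residues_def in_totatives_iff)
  qed
  thus ?thesis by (simp add: card_image totient_def)
qed

lemma mod_in_reduced_residues:
  assumes "q \<ge> 1" "coprime n (int q)"
  shows "n mod int q \<in> reduced_residues q"
  using assms by (auto simp: reduced_residues_def coprime_commute)

text \<open>
  A subgroup of the units modulo \<open>q\<close> is represented by the union \<open>S\<close> of its residue classes, so
  that characters of subgroups and of the whole group are functions on the same type \<^typ>\<open>int\<close>.
  Closure under inverses comes for free: by Euler's theorem the inverse of \<open>s\<close> is a power of \<open>s\<close>.
\<close>

locale partial_character =
  fixes q :: nat and S :: "int set" and \<eta> :: "int \<Rightarrow> complex"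
  assumes q_pos: "q \<ge> 1"
    and coprime: "m \<in> S \<Longrightarrow> coprime m (int q)"
    and one: "1 \<in> S"
    and mult_closed: "m \<in> S \<Longrightarrow> n \<in> S \<Longrightarrow> m * n \<in> S"
    and mult: "m \<in> S \<Longrightarrow> n \<in> S \<Longrightarrow> \<eta> (m * n) = \<eta> m * \<eta> n"
    and cong_closed: "m \<in> S \<Longrightarrow> [m = n] (mod int q) \<Longrightarrow> n \<in> S"
    and cong: "m \<in> S \<Longrightarrow> [m = n] (mod int q) \<Longrightarrow> \<eta> m = \<eta> n"
    and nonzero: "m \<in> S \<Longrightarrow> \<eta> m \<noteq> 0"
begin

lemma value_1: "\<eta> 1 = 1"
  using mult[OF one one] nonzero[OF one] by simp

lemma power_closed: "m \<in> S \<Longrightarrow> m ^ k \<in> S"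
  by (induction k) (auto intro: one mult_closed)

lemma value_power: "m \<in> S \<Longrightarrow> \<eta> (m ^ k) = \<eta> m ^ k"
  by (induction k) (auto simp: value_1 mult power_closed)

lemma cancel_closed:
  assumes "s \<in> S" "s * t \<in> S"
  shows "t \<in> S"
proof -
  have "s ^ (totient q - 1) * (s * t) \<in> S"
    using mult_closed[OF power_closed[OF assms(1)] assms(2)] .
  also have "s ^ (totient q - 1) * (s * t) = s ^ totient q * t"
    using q_pos power_minus_mult[of "totient q" s] by (simp add: mult.assoc[symmetric])
  finally have "s ^ totient q * t \<in> S" .
  moreover have "[s ^ totient q * t = t] (mod int q)"
    using cong_mult[OF euler_theorem_int[OF q_pos coprime[OF assms(1)]] cong_refl[of t]] by simp
  ultimately show ?thesis by (rule cong_closed)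
qed

text \<open>
  The exponents \<open>i\<close> with \<open>x ^ i \<in> S\<close> are the multiples of \<open>k\<close>.  So the rule
  \<open>s * x ^ i \<mapsto> \<eta> s * c ^ i\<close> is independent of the representation as soon as it is consistent at
  \<open>x ^ k\<close>, that is, for every \<open>k\<close>-th root \<open>c\<close> of \<open>\<eta> (x ^ k)\<close>.  The free choice of \<open>c\<close> is what makes
  separation of residues possible.
\<close>

lemma extend_by_one:
  assumes x: "coprime x (int q)" and k: "k > 0" "x ^ k \<in> S"
    and min: "\<And>j. 0 < j \<Longrightarrow> j < k \<Longrightarrow> x ^ j \<notin> S"
    and c: "c ^ k = \<eta> (x ^ k)"
  shows "\<exists>S' \<eta>'. partial_character q S' \<eta>' \<and> S \<subseteq> S' \<and> x \<in> S' \<and> (\<forall>s\<in>S. \<eta>' s = \<eta> s) \<and> \<eta>' x = c"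
proof -
  have c0: "c \<noteq> 0" using c nonzero[OF k(2)] k(1) by (auto simp: power_0_left)
  have dvd: "k dvd i" if "x ^ i \<in> S" for i
  proof -
    have "(x ^ k) ^ (i div k) * x ^ (i mod k) = x ^ i"
      by (simp flip: power_mult power_add)
    hence "x ^ (i mod k) \<in> S"
      using that cancel_closed[OF power_closed[OF k(2)]] by metis
    hence "i mod k = 0" using min[of "i mod k"] k(1) by (metis gr0I mod_less_divisor)
    thus ?thesis by (simp add: dvd_eq_mod_eq_0)
  qed
  \<comment> \<open>Comparing the two exponents reduces well-definedness to a multiple of \<open>k\<close>.\<close>
  have wd_le: "\<eta> s * c ^ i = \<eta> t * c ^ j"
    if st: "s \<in> S" "t \<in> S" "[s * x ^ i = t * x ^ j] (mod int q)" and "i \<le> j" for s t i j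
  proof -
    have "[x ^ i * s = x ^ i * (t * x ^ (j - i))] (mod int q)"
      using st(3) \<open>i \<le> j\<close> by (simp add: mult_ac flip: power_add)
    moreover have cop: "coprime (x ^ i) (int q)" using x by simp
    ultimately have *: "[s = t * x ^ (j - i)] (mod int q)"
      by (simp add: cong_mult_lcancel)
    hence "t * x ^ (j - i) \<in> S" using st(1) cong_closed by blast
    hence "x ^ (j - i) \<in> S" using cancel_closed st(2) by blast
    then obtain r where r: "j - i = k * r" using dvd by blast
    have "\<eta> s = \<eta> (t * x ^ (j - i))" using cong[OF st(1) *] .
    also have "\<dots> = \<eta> t * c ^ (j - i)"
      using st(2) k(2) by (simp add: r power_mult mult power_closed value_power c)
    finally show ?thesis using \<open>i \<le> j\<close> by (simp add: mult.assoc flip: power_add)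
  qed
  have wd: "\<eta> s * c ^ i = \<eta> t * c ^ j"
    if "s \<in> S" "t \<in> S" "[s * x ^ i = t * x ^ j] (mod int q)" for s t i j
    using wd_le[of s t i j] wd_le[of t s j i] that by (metis cong_sym nle_le)
  define S' where "S' = {n. \<exists>s\<in>S. \<exists>i. [s * x ^ i = n] (mod int q)}"
  define \<eta>' where "\<eta>' n = (SOME z. \<exists>s\<in>S. \<exists>i. [s * x ^ i = n] (mod int q) \<and> z = \<eta> s * c ^ i)" for n
  have val: "\<eta>' n = \<eta> s * c ^ i" if "s \<in> S" "[s * x ^ i = n] (mod int q)" for s i n
    unfolding \<eta>'_def
  proof (rule some_equality)
    show "\<exists>s'\<in>S. \<exists>i'. [s' * x ^ i' = n] (mod int q) \<and> \<eta> s * c ^ i = \<eta> s' * c ^ i'"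
      using that by blast
  next
    fix z assume "\<exists>s\<in>S. \<exists>i. [s * x ^ i = n] (mod int q) \<and> z = \<eta> s * c ^ i"
    then obtain t j where tj: "t \<in> S" "[t * x ^ j = n] (mod int q)" "z = \<eta> t * c ^ j" by blast
    have "[t * x ^ j = s * x ^ i] (mod int q)"
      using cong_trans[OF tj(2) cong_sym[OF that(2)]] .
    thus "z = \<eta> s * c ^ i" using wd[OF tj(1) that(1)] tj(3) by simp
  qed
  have mem: "n \<in> S'" if "s \<in> S" "[s * x ^ i = n] (mod int q)" for s i n
    using that unfolding S'_def by blast
  have "partial_character q S' \<eta>'"
  proof
    fix m assume "m \<in> S'"
    then obtain s i where si: "s \<in> S" "[s * x ^ i = m] (mod int q)" unfolding S'_def by blast
    show "coprime m (int q)"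
      using cong_imp_coprime[OF si(2)] coprime[OF si(1)] x by simp
    show "\<eta>' m \<noteq> 0" using val[OF si] nonzero[OF si(1)] c0 by simp
    fix n
    {
      assume "n \<in> S'"
      then obtain t j where tj: "t \<in> S" "[t * x ^ j = n] (mod int q)" unfolding S'_def by blast
      have st: "s * t \<in> S" "[(s * t) * x ^ (i + j) = m * n] (mod int q)"
        using mult_closed[OF si(1) tj(1)] cong_mult[OF si(2) tj(2)]
        by (simp_all add: power_add mult_ac)
      show "m * n \<in> S'" using mem[OF st] .
      show "\<eta>' (m * n) = \<eta>' m * \<eta>' n"
        using val[OF st] val[OF si] val[OF tj] mult[OF si(1) tj(1)] by (simp add: power_add)
    }
    assume "[m = n] (mod int q)"
    hence sn: "[s * x ^ i = n] (mod int q)" using si(2) cong_trans by blast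
    show "n \<in> S'" using mem[OF si(1) sn] .
    show "\<eta>' m = \<eta>' n" using val[OF si] val[OF si(1) sn] by simp
  qed (use q_pos mem[OF one, of 0 1] in auto)
  moreover have "\<eta>' s = \<eta> s" "s \<in> S'" if "s \<in> S" for s
    using val[OF that, of 0 s] mem[OF that, of 0 s] by simp_all
  moreover have "x \<in> S'" "\<eta>' x = c"
    using mem[OF one, of 1 x] val[OF one, of 1 x] value_1 by simp_all
  ultimately show ?thesis by blast
qed

lemma least_power_obtain:
  assumes "coprime x (int q)"
  obtains k where "k > 0" "x ^ k \<in> S" "\<And>j. 0 < j \<Longrightarrow> j < k \<Longrightarrow> x ^ j \<notin> S"
proof -
  define k where "k = (LEAST k. 0 < k \<and> x ^ k \<in> S)"
  have "0 < totient q \<and> x ^ totient q \<in> S"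
    using q_pos cong_closed[OF one] euler_theorem_int[OF q_pos assms] by (simp add: cong_sym)
  hence "0 < k \<and> x ^ k \<in> S" unfolding k_def by (rule LeastI)
  moreover have "x ^ j \<notin> S" if "0 < j" "j < k" for j
    using that not_less_Least[of j "\<lambda>k. 0 < k \<and> x ^ k \<in> S"] unfolding k_def by blast
  ultimately show ?thesis using that by blast
qed

end

text \<open>
  Residues are adjoined one at a time; every extension step leaves fewer reduced residues outside
  \<open>S\<close>, and a complex \<open>k\<close>-th root always exists.
\<close>

lemma partial_character_extends:
  assumes "partial_character q S \<eta>"
  shows "\<exists>\<psi>\<in>dirichlet_characters q. \<forall>s\<in>S. \<psi> s = \<eta> s"
  using assms
proof (induction "card (reduced_residues q - S)" arbitrary: S \<eta> rule: less_induct)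
  case less
  interpret partial_character q S \<eta> by fact
  show ?case
  proof (cases "reduced_residues q \<subseteq> S")
    case True
    have all: "n \<in> S \<longleftrightarrow> coprime n (int q)" for n
      using True coprime mod_in_reduced_residues[OF q_pos, of n] cong_closed[of "n mod int q" n]
      by (auto simp: cong_def)
    define \<psi> where "\<psi> n = (if coprime n (int q) then \<eta> n else 0)" for n
    have "coprime (n + int q) (int q) \<longleftrightarrow> coprime n (int q)" for n
      by (simp add: coprime_iff_gcd_eq_1)
    moreover have "\<eta> (n + int q) = \<eta> n" if "coprime n (int q)" for n
      using that cong[of n "n + int q"] by (simp add: all cong_def)
    ultimately have "\<psi> (n + int q) = \<psi> n" for n
      unfolding \<psi>_def by presburger
    moreover have "\<psi> (m * n) = \<psi> m * \<psi> n" for m n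
      using mult[of m n] by (simp add: \<psi>_def all)
    moreover have "\<psi> n \<noteq> 0 \<longleftrightarrow> coprime n (int q)" for n
      using nonzero[of n] by (simp add: \<psi>_def all)
    ultimately have "\<psi> \<in> dirichlet_characters q" by (simp add: dirichlet_characters_def)
    thus ?thesis using all by (intro bexI[of _ \<psi>]) (simp_all add: \<psi>_def)
  next
    case False
    then obtain x where x: "x \<in> reduced_residues q" "x \<notin> S" by blast
    hence cop: "coprime x (int q)" by (simp add: reduced_residues_def)
    obtain k where k: "k > 0" "x ^ k \<in> S" "\<And>j. 0 < j \<Longrightarrow> j < k \<Longrightarrow> x ^ j \<notin> S"
      using least_power_obtain[OF cop] by blast
    obtain c where "\<eta> (x ^ k) = c ^ k"
      using exists_complex_root[of k "\<eta> (x ^ k)"] k(1) by blast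
    hence "c ^ k = \<eta> (x ^ k)" by simp
    from extend_by_one[OF cop k this] obtain S' \<eta>' where
      S': "partial_character q S' \<eta>'" "S \<subseteq> S'" "x \<in> S'" "\<forall>s\<in>S. \<eta>' s = \<eta> s"
      by blast
    have "card (reduced_residues q - S') < card (reduced_residues q - S)"
      using S' x by (intro psubset_card_mono) auto
    from less(1)[OF this S'(1)] obtain \<psi> where
      "\<psi> \<in> dirichlet_characters q" "\<forall>s\<in>S'. \<psi> s = \<eta>' s" by blast
    thus ?thesis using S'(2,4) by (intro bexI[of _ \<psi>]) auto
  qed
qed

text \<open>
  Start from the trivial subgroup.  The order \<open>k\<close> of \<open>g\<close> is at least 2, so there is a \<open>k\<close>-th root
  of unity other than 1 to which \<open>g\<close> can be sent.
\<close>

lemma dirichlet_character_separates: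
  assumes q: "q \<ge> 1" and g: "coprime g (int q)" "\<not> [g = 1] (mod int q)"
  shows "\<exists>\<psi>\<in>dirichlet_characters q. \<psi> g \<noteq> 1"
proof -
  interpret partial_character q "{n. [1 = n] (mod int q)}" "\<lambda>_. 1"
  proof
    fix m assume m: "m \<in> {n. [1 = n] (mod int q)}"
    show "coprime m (int q)" using m cong_imp_coprime[of 1 m "int q"] by simp
    show "m * n \<in> {n. [1 = n] (mod int q)}" if "n \<in> {n. [1 = n] (mod int q)}" for n
      using m that cong_mult[of 1 m "int q" 1 n] by simp
    show "n \<in> {n. [1 = n] (mod int q)}" if "[m = n] (mod int q)" for n
      using m that cong_trans by blast
  qed (use q in auto)
  obtain k where k: "k > 0" "g ^ k \<in> {n. [1 = n] (mod int q)}"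
      "\<And>j. 0 < j \<Longrightarrow> j < k \<Longrightarrow> g ^ j \<notin> {n. [1 = n] (mod int q)}"
    using least_power_obtain[OF g(1)] by blast
  have "k \<noteq> 1" using k(2) g(2) by (auto simp: cong_sym_eq)
  hence k2: "k \<ge> 2" using k(1) by simp
  have "\<exists>z::complex. z ^ k = 1 \<and> z \<noteq> 1"
  proof (rule ccontr)
    assume "\<not> ?thesis"
    hence "{z::complex. z ^ k = 1} \<subseteq> {1}" by blast
    hence "card {z::complex. z ^ k = 1} \<le> 1" using card_mono[of "{1::complex}"] by fastforce
    thus False using card_roots_unity_eq[OF k(1)] k2 by simp
  qed
  then obtain z :: complex where z: "z ^ k = 1" "z \<noteq> 1" by blast
  from extend_by_one[OF g(1) k z(1)] obtain S' \<eta>' where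
    "partial_character q S' \<eta>'" "g \<in> S'" "\<eta>' g = z" by blast
  thus ?thesis using partial_character_extends[of q S' \<eta>'] z(2) by metis
qed

section \<open>Orthogonality of Dirichlet characters\<close>

context
  fixes q :: nat and \<psi> :: "int \<Rightarrow> complex"
  assumes q: "q \<ge> 1" and \<psi>: "\<psi> \<in> dirichlet_characters q"
begin

lemma dirichlet_character_mult: "\<psi> (m * n) = \<psi> m * \<psi> n"
  using \<psi> by (simp add: dirichlet_characters_def)

lemma dirichlet_character_eq_0_iff: "\<psi> n = 0 \<longleftrightarrow> \<not> coprime n (int q)"
  using \<psi> by (auto simp: dirichlet_characters_def)

lemma dirichlet_character_1: "\<psi> 1 = 1"
  using dirichlet_character_mult[of 1 1] dirichlet_character_eq_0_iff[of 1] by simp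

lemma dirichlet_character_power: "\<psi> (n ^ k) = \<psi> n ^ k"
  by (induction k) (simp_all add: dirichlet_character_1 dirichlet_character_mult)

lemma dirichlet_character_mod: "\<psi> (n mod int q) = \<psi> n"
proof -
  have per: "\<psi> (m + int q * int k) = \<psi> m" for m k
  proof (induction k)
    case (Suc k)
    have "\<psi> (m + int q * int (Suc k)) = \<psi> ((m + int q * int k) + int q)"
      by (simp add: algebra_simps)
    also have "\<dots> = \<psi> (m + int q * int k)" using \<psi> by (simp add: dirichlet_characters_def)
    finally show ?case using Suc by simp
  qed simp
  have dec: "n = n mod int q + int q * (n div int q)" by simp
  show ?thesis
  proof (cases "n div int q \<ge> 0")
    case True
    thus ?thesis using per[of "n mod int q" "nat (n div int q)"] by simp
  next
    case False
    thus ?thesis using per[of n "nat (- (n div int q))"] by (simp add: minus_mult_div_eq_mod)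
  qed
qed

lemma dirichlet_character_cong: "[m = n] (mod int q) \<Longrightarrow> \<psi> m = \<psi> n"
  using dirichlet_character_mod[of m] dirichlet_character_mod[of n] by (simp add: cong_def)

lemma dirichlet_character_power_totient:
  assumes "coprime n (int q)"
  shows "\<psi> n ^ totient q = 1"
  using dirichlet_character_cong[OF euler_theorem_int[OF q assms]]
  by (simp add: dirichlet_character_power dirichlet_character_1)

lemma norm_dirichlet_character_coprime:
  assumes "coprime n (int q)"
  shows "norm (\<psi> n) = 1"
proof -
  have "totient q \<noteq> 0" using q by simp
  thus ?thesis using power_eq_1_iff[OF dirichlet_character_power_totient[OF assms]] by simp
qed

lemma norm_dirichlet_character_le_1: "norm (\<psi> n) \<le> 1"
  using norm_dirichlet_character_coprime[of n] dirichlet_character_eq_0_iff[of n] by force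

text \<open>
  The values at units have absolute value 1, so conjugation inverts them.
\<close>

lemma cnj_dirichlet_character:
  assumes "[a * b = 1] (mod int q)"
  shows "cnj (\<psi> a) = \<psi> b"
proof -
  have "coprime a (int q)"
    using assms coprime_iff_invertible_int by blast
  hence *: "cnj (\<psi> a) * \<psi> a = 1"
    using norm_dirichlet_character_coprime complex_norm_square[of "\<psi> a"] by (simp add: mult.commute)
  have "\<psi> a * \<psi> b = 1"
    using dirichlet_character_cong[OF assms] by (simp add: dirichlet_character_1 dirichlet_character_mult)
  thus ?thesis using * by (metis mult.assoc mult_1 mult.right_neutral)
qed

end

lemma dirichlet_character_eqI:
  assumes "q \<ge> 1" "\<psi> \<in> dirichlet_characters q" "\<psi>' \<in> dirichlet_characters q"
    and "\<And>n. n \<in> reduced_residues q \<Longrightarrow> \<psi> n = \<psi>' n"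
  shows "\<psi> = \<psi>'"
proof
  fix n
  show "\<psi> n = \<psi>' n"
  proof (cases "coprime n (int q)")
    case True
    thus ?thesis
      using assms(4)[OF mod_in_reduced_residues[OF assms(1) True]]
      by (simp add: dirichlet_character_mod[OF assms(1,2)] dirichlet_character_mod[OF assms(1,3)])
  next
    case False
    thus ?thesis
      using dirichlet_character_eq_0_iff[OF assms(1,2), of n]
        dirichlet_character_eq_0_iff[OF assms(1,3), of n] by simp
  qed
qed

lemma finite_dirichlet_characters:
  assumes "q \<ge> 1"
  shows "finite (dirichlet_characters q)"
proof (rule finite_imageD)
  let ?res = "\<lambda>\<psi>. restrict \<psi> (reduced_residues q)"
  have "?res ` dirichlet_characters q \<subseteq> (\<Pi>\<^sub>E n\<in>reduced_residues q. {z::complex. z ^ totient q = 1})"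
    using dirichlet_character_power_totient[OF assms]
    by (intro image_subsetI restrict_PiE_iff[THEN iffD2]) (auto simp: reduced_residues_def)
  thus "finite (?res ` dirichlet_characters q)"
    by (rule finite_subset) (use assms in \<open>auto intro!: finite_PiE finite_roots_unity simp: Suc_le_eq\<close>)
  show "inj_on ?res (dirichlet_characters q)"
  proof (intro inj_onI dirichlet_character_eqI)
    fix \<psi> \<psi>' n assume "?res \<psi> = ?res \<psi>'" "n \<in> reduced_residues q"
    thus "\<psi> n = \<psi>' n" by (metis restrict_apply')
  qed (use assms in auto)
qed

definition principal_character :: "nat \<Rightarrow> int \<Rightarrow> complex" where
  "principal_character q n = (if coprime n (int q) then 1 else 0)"

lemma principal_character_in: "principal_character q \<in> dirichlet_characters q"
proof -
  have "coprime (n + int q) (int q) \<longleftrightarrow> coprime n (int q)" for n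
    by (simp add: coprime_iff_gcd_eq_1)
  thus ?thesis by (simp add: dirichlet_characters_def principal_character_def)
qed

text \<open>
  Multiplication by a character \<open>\<psi>0\<close> with \<open>\<psi>0 m \<noteq> 1\<close> permutes the characters and multiplies the
  sum by \<open>\<psi>0 m\<close>.
\<close>

lemma sum_dirichlet_characters_eq_0:
  assumes q: "q \<ge> 1" and m: "\<not> [m = 1] (mod int q)"
  shows "(\<Sum>\<psi>\<in>dirichlet_characters q. \<psi> m) = 0"
proof (cases "coprime m (int q)")
  case False
  hence "\<psi> m = 0" if "\<psi> \<in> dirichlet_characters q" for \<psi>
    using dirichlet_character_eq_0_iff[OF q that] by simp
  thus ?thesis by (intro sum.neutral ballI)
next
  case True
  then obtain \<psi>0 where \<psi>0: "\<psi>0 \<in> dirichlet_characters q" "\<psi>0 m \<noteq> 1"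
    using dirichlet_character_separates[OF q _ m] by blast
  let ?T = "\<lambda>\<psi> n. \<psi>0 n * \<psi> n"
  have inj: "inj_on ?T (dirichlet_characters q)"
  proof (intro inj_onI dirichlet_character_eqI)
    fix \<psi> \<psi>' n assume "?T \<psi> = ?T \<psi>'" "n \<in> reduced_residues q"
    moreover have "\<psi>0 n \<noteq> 0"
      using calculation(2) dirichlet_character_eq_0_iff[OF q \<psi>0(1)] by (simp add: reduced_residues_def)
    ultimately show "\<psi> n = \<psi>' n" by (metis (no_types, lifting) mult_cancel_left)
  qed (use q in auto)
  have "?T ` dirichlet_characters q \<subseteq> dirichlet_characters q"
    using \<psi>0(1) by (auto simp: dirichlet_characters_def mult_ac)
  hence "?T ` dirichlet_characters q = dirichlet_characters q"
    using inj finite_dirichlet_characters[OF q] by (simp add: endo_inj_surj)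
  hence "bij_betw ?T (dirichlet_characters q) (dirichlet_characters q)"
    using inj by (simp add: bij_betw_def)
  hence "(\<Sum>\<psi>\<in>dirichlet_characters q. \<psi> m) = (\<Sum>\<psi>\<in>dirichlet_characters q. ?T \<psi> m)"
    by (rule sum.reindex_bij_betw[symmetric])
  also have "\<dots> = \<psi>0 m * (\<Sum>\<psi>\<in>dirichlet_characters q. \<psi> m)" by (simp add: sum_distrib_left)
  finally show ?thesis using \<psi>0(2) by simp
qed

text \<open>
  Dual to the previous argument: multiplication by \<open>m\<close> with \<open>\<psi> m \<noteq> 1\<close> permutes the reduced
  residues.
\<close>

lemma sum_reduced_residues_eq_0:
  assumes q: "q \<ge> 1" and \<psi>: "\<psi> \<in> dirichlet_characters q" "\<psi> \<noteq> principal_character q"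
  shows "(\<Sum>n\<in>reduced_residues q. \<psi> n) = 0"
proof -
  have "\<exists>m. coprime m (int q) \<and> \<psi> m \<noteq> 1"
  proof (rule ccontr)
    assume "\<not> ?thesis"
    hence "\<psi> n = principal_character q n" for n
      using dirichlet_character_eq_0_iff[OF q \<psi>(1), of n] by (auto simp: principal_character_def)
    thus False using \<psi>(2) by (simp add: fun_eq_iff)
  qed
  then obtain m where m: "coprime m (int q)" "\<psi> m \<noteq> 1" by blast
  let ?T = "\<lambda>n. m * n mod int q"
  have inj: "inj_on ?T (reduced_residues q)"
  proof (rule inj_onI)
    fix n n' assume n: "n \<in> reduced_residues q" "n' \<in> reduced_residues q" "?T n = ?T n'"
    hence "[n = n'] (mod int q)" using m(1) by (simp add: cong_mult_lcancel flip: cong_def)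
    thus "n = n'" using n by (auto simp: reduced_residues_def cong_def)
  qed
  have "?T ` reduced_residues q \<subseteq> reduced_residues q"
    using m(1) by (auto intro!: mod_in_reduced_residues q simp: reduced_residues_def)
  hence "bij_betw ?T (reduced_residues q) (reduced_residues q)"
    using inj by (simp add: bij_betw_def endo_inj_surj)
  hence "(\<Sum>n\<in>reduced_residues q. \<psi> n) = (\<Sum>n\<in>reduced_residues q. \<psi> (?T n))"
    by (rule sum.reindex_bij_betw[symmetric])
  also have "\<dots> = \<psi> m * (\<Sum>n\<in>reduced_residues q. \<psi> n)"
    by (simp add: sum_distrib_left dirichlet_character_mod[OF q \<psi>(1)]
        dirichlet_character_mult[OF q \<psi>(1)])
  finally show ?thesis using m(2) by simp
qed

text \<open>
  Evaluate \<open>\<Sum>n. \<Sum>\<psi>. \<psi> n\<close> in both orders: summing over characters first leaves only the residue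
  of 1, summing over residues first leaves only the principal character.
\<close>

lemma card_dirichlet_characters:
  assumes q: "q \<ge> 1"
  shows "card (dirichlet_characters q) = totient q"
proof -
  let ?D = "dirichlet_characters q" and ?R = "reduced_residues q"
  note fin = finite_dirichlet_characters[OF q]
  define u where "u = 1 mod int q"
  have u: "u \<in> ?R" unfolding u_def by (intro mod_in_reduced_residues q) auto
  have "(\<Sum>\<psi>\<in>?D. \<psi> n) = (if n = u then of_nat (card ?D) else 0)" if "n \<in> ?R" for n
  proof (cases "n = u")
    case True
    have "\<psi> n = 1" if "\<psi> \<in> ?D" for \<psi>
      using True dirichlet_character_mod[OF q that, of 1] dirichlet_character_1[OF q that]
      by (simp add: u_def)
    hence "(\<Sum>\<psi>\<in>?D. \<psi> n) = (\<Sum>\<psi>\<in>?D. 1)" by (rule sum.cong[OF refl])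
    thus ?thesis using True by simp
  next
    case False
    hence "\<not> [n = 1] (mod int q)"
      using that by (auto simp: cong_def u_def reduced_residues_def)
    thus ?thesis using False sum_dirichlet_characters_eq_0[OF q] by simp
  qed
  hence "(\<Sum>n\<in>?R. \<Sum>\<psi>\<in>?D. \<psi> n) = (\<Sum>n\<in>?R. if n = u then of_nat (card ?D) else 0)"
    by (rule sum.cong[OF refl])
  hence "(\<Sum>n\<in>?R. \<Sum>\<psi>\<in>?D. \<psi> n) = of_nat (card ?D)" using u by simp
  moreover have "(\<Sum>n\<in>?R. \<psi> n) = (if \<psi> = principal_character q then of_nat (totient q) else 0)"
    if "\<psi> \<in> ?D" for \<psi>
  proof (cases "\<psi> = principal_character q")
    case True
    have "(\<Sum>n\<in>?R. \<psi> n) = (\<Sum>n\<in>?R. 1)"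
      by (intro sum.cong) (auto simp: True principal_character_def reduced_residues_def)
    thus ?thesis using True card_reduced_residues[OF q] by simp
  qed (use that sum_reduced_residues_eq_0[OF q] in auto)
  hence "(\<Sum>\<psi>\<in>?D. \<Sum>n\<in>?R. \<psi> n) =
      (\<Sum>\<psi>\<in>?D. if \<psi> = principal_character q then of_nat (totient q) else 0)"
    by (rule sum.cong[OF refl])
  hence "(\<Sum>\<psi>\<in>?D. \<Sum>n\<in>?R. \<psi> n) = of_nat (totient q)"
    using principal_character_in fin by simp
  ultimately have "(of_nat (card ?D) :: complex) = of_nat (totient q)"
    using sum.swap[of "\<lambda>n \<psi>. \<psi> n" ?D ?R] by simp
  thus ?thesis by simp
qed

lemma dirichlet_character_orthogonality:
  assumes q: "q \<ge> 1" and a: "coprime a (int q)"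
  shows "(\<Sum>\<psi>\<in>dirichlet_characters q. cnj (\<psi> a) / of_nat (totient q) * \<psi> n) =
    of_bool ([n = a] (mod int q))"
proof -
  obtain b where b: "[a * b = 1] (mod int q)" using a cong_solve_coprime_int by blast
  have "cnj (\<psi> a) / of_nat (totient q) * \<psi> n = \<psi> (b * n) / of_nat (totient q)"
    if "\<psi> \<in> dirichlet_characters q" for \<psi>
    using cnj_dirichlet_character[OF q that b] dirichlet_character_mult[OF q that] by simp
  hence eq: "(\<Sum>\<psi>\<in>dirichlet_characters q. cnj (\<psi> a) / of_nat (totient q) * \<psi> n) =
      (\<Sum>\<psi>\<in>dirichlet_characters q. \<psi> (b * n)) / of_nat (totient q)"
    unfolding sum_divide_distrib by (rule sum.cong[OF refl])
  have iff: "[b * n = 1] (mod int q) \<longleftrightarrow> [n = a] (mod int q)"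
  proof
    assume "[b * n = 1] (mod int q)"
    hence "[a * (b * n) = a * 1] (mod int q)" by (rule cong_scalar_left)
    moreover have "[a * b * n = 1 * n] (mod int q)" using b by (rule cong_scalar_right)
    ultimately show "[n = a] (mod int q)" by (metis cong_sym cong_trans mult.assoc mult_1 mult.right_neutral)
  next
    assume "[n = a] (mod int q)"
    hence "[b * n = b * a] (mod int q)" by (rule cong_scalar_left)
    thus "[b * n = 1] (mod int q)" using b by (metis cong_trans mult.commute)
  qed
  show ?thesis
  proof (cases "[n = a] (mod int q)")
    case True
    have "\<psi> (b * n) = 1" if "\<psi> \<in> dirichlet_characters q" for \<psi>
      using dirichlet_character_cong[OF q that, of "b * n" 1] iff True
        dirichlet_character_1[OF q that] by simp
    hence "(\<Sum>\<psi>\<in>dirichlet_characters q. \<psi> (b * n)) = (\<Sum>\<psi>\<in>dirichlet_characters q. 1)"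
      by (rule sum.cong[OF refl])
    thus ?thesis using True q unfolding eq by (simp add: card_dirichlet_characters)
  next
    case False
    thus ?thesis using sum_dirichlet_characters_eq_0[OF q, of "b * n"] iff unfolding eq by simp
  qed
qed

section \<open>Moebius inversion\<close>

text \<open>
  For a prime \<open>p\<close> dividing \<open>n\<close>, the map \<open>d \<mapsto> p * d\<close> pairs the squarefree divisors prime to \<open>p\<close>
  with those divisible by \<open>p\<close>, and it flips the sign of the Moebius function.
\<close>

lemma sum_moebius_divisors:
  fixes n :: nat
  assumes "n > 0"
  shows "(\<Sum>d | d dvd n. moebius d) = of_bool (n = 1)"
proof (cases "n = 1")
  case True
  thus ?thesis by (simp add: moebius_def)
next
  case False
  obtain p where p: "prime p" "p dvd n" using False prime_factor_nat by blast
  define A where "A = {d. d dvd n \<and> squarefree d \<and> \<not> p dvd d}"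
  define B where "B = {d. d dvd n \<and> squarefree d \<and> p dvd d}"
  have fin: "finite {d. d dvd n}" using assms by simp
  have finAB: "finite A" "finite B"
    by (rule finite_subset[OF _ fin]; auto simp: A_def B_def)+
  have cop: "coprime p d" if "d \<in> A" for d
    using that p prime_imp_coprime by (auto simp: A_def)
  have sqp: "squarefree p" using p(1) by (simp add: squarefree_prime)
  have mu: "moebius (p * d) = - moebius d" if "d \<in> A" for d
  proof -
    have sq: "squarefree d" "squarefree (p * d)"
      using that squarefree_mult_coprime[OF cop[OF that] sqp] by (auto simp: A_def)
    have d0: "d \<noteq> 0" using sq(1) by (metis not_squarefree_0)
    have "prime_factors (p * d) = insert p (prime_factors d)"
      using p d0 by (simp add: prime_factors_product prime_prime_factors)
    moreover have "p \<notin> prime_factors d" using that by (auto simp: A_def)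
    ultimately show ?thesis using sq by (simp add: moebius_def)
  qed
  have bij: "bij_betw (\<lambda>d. p * d) A B"
  proof (rule bij_betwI[where g = "\<lambda>d. d div p"])
    show "(\<lambda>d. p * d) \<in> A \<rightarrow> B"
    proof
      fix d assume d: "d \<in> A"
      thus "p * d \<in> B"
        using p cop[OF d] squarefree_mult_coprime[OF cop[OF d] sqp]
        by (auto simp: A_def B_def intro!: divides_mult)
    qed
    show "(\<lambda>d. d div p) \<in> B \<rightarrow> A"
    proof
      fix d assume d: "d \<in> B"
      then obtain e where e: "d = p * e" by (auto simp: B_def)
      have "\<not> p dvd e"
      proof
        assume "p dvd e"
        hence "p ^ 2 dvd d" by (auto simp: e power2_eq_square)
        hence "is_unit p" using d by (auto simp: B_def squarefree_def)
        thus False using p(1) by auto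
      qed
      moreover have "squarefree e" using d e by (auto simp: B_def dest: squarefree_multD)
      moreover have "e dvd n" using d e by (auto simp: B_def dest: dvd_mult_right)
      ultimately show "d div p \<in> A" using p e prime_gt_0_nat[of p] by (simp add: A_def)
    qed
  qed (use p prime_gt_0_nat[of p] in \<open>auto simp: B_def\<close>)
  have "(\<Sum>d | d dvd n. moebius d) = (\<Sum>d\<in>A \<union> B. moebius d)"
    by (rule sum.mono_neutral_right) (use fin in \<open>auto simp: A_def B_def moebius_def\<close>)
  also have "\<dots> = (\<Sum>d\<in>A. moebius d) + (\<Sum>d\<in>B. moebius d)"
    by (rule sum.union_disjoint) (use finAB in \<open>auto simp: A_def B_def\<close>)
  also have "(\<Sum>d\<in>B. moebius d) = (\<Sum>d\<in>A. moebius (p * d))"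
    by (rule sum.reindex_bij_betw[OF bij, symmetric])
  also have "\<dots> = - (\<Sum>d\<in>A. moebius d)" using mu by (simp add: sum_negf)
  finally show ?thesis using False by simp
qed

lemma abs_moebius_le_1: "\<bar>moebius n\<bar> \<le> 1"
  by (simp add: moebius_def power_abs)

text \<open>
  A chain \<open>e dvd d dvd n\<close> is the same as a divisor \<open>e\<close> of \<open>n\<close> with a divisor \<open>m = d div e\<close> of
  \<open>n div e\<close>.
\<close>

lemma sum_divisors_of_divisors:
  fixes n :: nat and f :: "nat \<Rightarrow> nat \<Rightarrow> 'a :: comm_monoid_add"
  assumes "n > 0"
  shows "(\<Sum>d | d dvd n. \<Sum>e | e dvd d. f e (d div e)) = (\<Sum>e | e dvd n. \<Sum>m | m dvd n div e. f e m)"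
proof -
  have fin: "finite {e. e dvd d}" if "d dvd n" for d
    using that assms by (auto intro!: finite_divisors_nat intro: Nat.gr0I)
  have fin': "finite {m. m dvd n div e}" if "e dvd n" for e
    using that assms by (intro finite_divisors_nat) (auto simp: dvd_div_eq_0_iff intro!: Nat.gr0I)
  have "(\<Sum>(d, e)\<in>(SIGMA d:{d. d dvd n}. {e. e dvd d}). f e (d div e)) =
        (\<Sum>(e, m)\<in>(SIGMA e:{e. e dvd n}. {m. m dvd n div e}). f e m)"
  proof (rule sum.reindex_bij_witness[where j = "\<lambda>(d, e). (e, d div e)" and i = "\<lambda>(e, m). (e * m, e)"])
    fix x assume "x \<in> (SIGMA d:{d. d dvd n}. {e. e dvd d})"
    thus "(case x of (d, e) \<Rightarrow> (e, d div e)) \<in> (SIGMA e:{e. e dvd n}. {m. m dvd n div e})"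
      using assms by (auto intro: dvd_trans div_dvd_div)
  next
    fix x assume x: "x \<in> (SIGMA e:{e. e dvd n}. {m. m dvd n div e})"
    then obtain e m where em: "x = (e, m)" "e dvd n" "m dvd n div e" by auto
    hence "e > 0" using assms by (auto intro: Nat.gr0I)
    have "e * m dvd n" using em by (metis dvd_mult_div_cancel mult_dvd_mono dvd_refl)
    thus "(case x of (e, m) \<Rightarrow> (e * m, e)) \<in> (SIGMA d:{d. d dvd n}. {e. e dvd d})"
      by (auto simp: em)
    show "(case case x of (e, m) \<Rightarrow> (e * m, e) of (d, e) \<Rightarrow> (e, d div e)) = x"
      using \<open>e > 0\<close> by (simp add: em)
  qed auto
  thus ?thesis using assms fin fin' by (simp add: sum.Sigma)
qed

text \<open>
  This is the Moebius inversion of the defining formula of \<^const>\<open>wcoeff\<close>; it expresses the formal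
  identity \<open>H t = (\<Prod>k\<ge>1. (1 - t ^ k) powr wcoeff H k)\<close> on coefficients of the logarithms.
\<close>

lemma sum_of_nat_times_wcoeff:
  assumes "n > 0"
  shows "(\<Sum>d | d dvd n. of_nat d * wcoeff H d) = inv_root_power_sum H n"
proof -
  let ?s = "inv_root_power_sum H"
  have "(\<Sum>d | d dvd n. of_nat d * wcoeff H d) =
      (\<Sum>d | d dvd n. \<Sum>e | e dvd d. of_int (moebius (d div e)) * ?s e)"
    using assms by (intro sum.cong refl) (auto simp: wcoeff_def intro: Nat.gr0I)
  also have "\<dots> = (\<Sum>e | e dvd n. \<Sum>m | m dvd n div e. of_int (moebius m) * ?s e)"
    by (rule sum_divisors_of_divisors[OF assms])
  also have "\<dots> = (\<Sum>e | e dvd n. of_bool (e = n) * ?s e)"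
  proof (rule sum.cong[OF refl], clarify)
    fix e assume e: "e dvd n"
    hence pos: "n div e > 0" using assms by (auto simp: dvd_div_eq_0_iff intro!: Nat.gr0I)
    have "(\<Sum>m | m dvd n div e. of_int (moebius m) * ?s e) = of_int (\<Sum>m | m dvd n div e. moebius m) * ?s e"
      by (simp add: sum_distrib_right)
    also have "(\<Sum>m | m dvd n div e. moebius m) = of_bool (n div e = 1)"
      by (rule sum_moebius_divisors[OF pos])
    also have "n div e = 1 \<longleftrightarrow> e = n" using e assms by (auto elim!: dvdE)
    finally show "(\<Sum>m | m dvd n div e. of_int (moebius m) * ?s e) = of_bool (e = n) * ?s e" by simp
  qed
  also have "\<dots> = (\<Sum>e | e dvd n. if e = n then ?s n else 0)" by (intro sum.cong) auto
  also have "\<dots> = ?s n" using assms by simp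
  finally show ?thesis .
qed

section \<open>Power sums of inverse roots\<close>

lemma poly_eq_prod_inverse_roots:
  fixes H :: "complex poly"
  assumes "poly H 0 = 1"
  shows "H = (\<Prod>\<rho>\<in>#proots H. [:1, - inverse \<rho>:])"
proof -
  have "H \<noteq> 0" using assms by auto
  hence nz: "\<rho> \<noteq> 0" if "\<rho> \<in># proots H" for \<rho> using that assms by auto
  have lin: "[:- \<rho>, 1:] = Polynomial.smult (- \<rho>) [:1, - inverse \<rho>:]" if "\<rho> \<in># proots H" for \<rho>
    using nz[OF that] by simp
  have "H = Polynomial.smult (lead_coeff H) (\<Prod>\<rho>\<in>#proots H. [:- \<rho>, 1:])"
    by (rule complex_poly_decompose_multiset[symmetric])
  also have "(\<Prod>\<rho>\<in>#proots H. [:- \<rho>, 1:]) = (\<Prod>\<rho>\<in>#proots H. Polynomial.smult (- \<rho>) [:1, - inverse \<rho>:])"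
    by (intro arg_cong[of _ _ prod_mset] image_mset_cong lin)
  also have "\<dots> = Polynomial.smult (\<Prod>\<rho>\<in>#proots H. - \<rho>) (\<Prod>\<rho>\<in>#proots H. [:1, - inverse \<rho>:])"
  proof -
    have "(\<Prod>\<rho>\<in>#M. Polynomial.smult (- \<rho>) [:1, - inverse \<rho>:]) =
        Polynomial.smult (\<Prod>\<rho>\<in>#M. - \<rho>) (\<Prod>\<rho>\<in>#M. [:1, - inverse \<rho>:])" for M :: "complex multiset"
    proof (induction M)
      case (add \<rho> M)
      show ?case
        by (simp only: image_mset_add_mset prod_mset.add_mset add.IH mult_smult_left
            mult_smult_right smult_smult mult_ac)
    qed simp
    thus ?thesis .
  qed
  finally obtain c where c: "H = Polynomial.smult c (\<Prod>\<rho>\<in>#proots H. [:1, - inverse \<rho>:])" by auto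
  have "poly (\<Prod>\<rho>\<in>#M. [:1, - inverse \<rho>:]) 0 = 1" for M :: "complex multiset"
    by (induction M) auto
  hence "c = 1" using assms by (subst (asm) c) simp
  thus ?thesis using c by simp
qed

text \<open>
  Two polynomials with constant term 1 and the same linear coefficient have the same first power sum; this is how the
  vanishing of \<open>F'\<close> at 0 enters.
\<close>

lemma inv_root_power_sum_1:
  assumes "poly H 0 = 1"
  shows "inv_root_power_sum H 1 = - Polynomial.coeff H 1"
proof -
  have "Polynomial.coeff (\<Prod>\<rho>\<in>#M. [:1, - inverse \<rho>:]) 0 = 1 \<and>
      Polynomial.coeff (\<Prod>\<rho>\<in>#M. [:1, - inverse \<rho>:]) 1 = - (\<Sum>\<rho>\<in>#M. inverse \<rho>)" for M :: "complex multiset"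
    by (induction M) (auto simp: coeff_mult)
  from this[of "proots H"] show ?thesis
    using poly_eq_prod_inverse_roots[OF assms] by (simp add: inv_root_power_sum_def)
qed

lemma has_sum_log_one_minus:
  fixes z :: complex
  assumes "norm z < 1"
  shows "((\<lambda>k. z ^ k / of_nat k) has_sum (- ln (1 - z))) {1..}"
proof -
  have "(\<lambda>k. - (z ^ k / of_nat k)) sums ln (1 - z)"
    using Ln_series'[of "- z"] assms by simp
  hence "(\<lambda>k. z ^ k / of_nat k) sums (- ln (1 - z))"
    using sums_minus by fastforce
  moreover have "summable (\<lambda>k. norm (z ^ k / of_nat k))"
  proof (rule summable_comparison_test)
    show "summable (\<lambda>k. norm z ^ k)" using assms by (simp add: summable_geometric)
    show "\<exists>N. \<forall>n\<ge>N. norm (norm (z ^ n / of_nat n)) \<le> norm z ^ n"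
      by (intro exI[of _ 1]) (auto simp: norm_divide norm_power divide_le_eq mult_le_cancel_left1)
  qed
  ultimately have "((\<lambda>k. z ^ k / of_nat k) has_sum (- ln (1 - z))) UNIV"
    by (intro norm_summable_imp_has_sum)
  thus ?thesis
    by (rule has_sum_cong_neutral[THEN iffD1, rotated -1]) (auto simp: not_le)
qed

text \<open>
  The logarithm \<open>l\<close> is the sum of the principal logarithms of the factors \<open>1 - t / \<rho>\<close>.  It may differ
  from the principal logarithm of \<open>poly H t\<close> by a multiple of \<open>2 \<pi> i\<close>, so it is only characterized by
  its series and its exponential.
\<close>

lemma poly_eq_exp_inv_root_power_sums:
  assumes H: "poly H 0 = 1" and small: "\<And>\<rho>. poly H \<rho> = 0 \<Longrightarrow> norm (t / \<rho>) < 1"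
  obtains l where "((\<lambda>k. inv_root_power_sum H k * t ^ k / of_nat k) has_sum - l) {1..}"
    and "exp l = poly H t"
proof -
  have "\<exists>l. ((\<lambda>k. (\<Sum>\<rho>\<in>#M. inverse \<rho> ^ k) * t ^ k / of_nat k) has_sum - l) {1..} \<and>
      exp l = poly (\<Prod>\<rho>\<in>#M. [:1, - inverse \<rho>:]) t"
    if "\<forall>\<rho>\<in>#M. norm (t / \<rho>) < 1" for M
    using that
  proof (induction M)
    case empty
    show ?case by (intro exI[of _ 0]) auto
  next
    case (add \<rho> M)
    then obtain l where l: "((\<lambda>k. (\<Sum>\<rho>\<in>#M. inverse \<rho> ^ k) * t ^ k / of_nat k) has_sum - l) {1..}"
      "exp l = poly (\<Prod>\<rho>\<in>#M. [:1, - inverse \<rho>:]) t" by auto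
    have n: "norm (t / \<rho>) < 1" using add.prems by simp
    have "((\<lambda>k. (t / \<rho>) ^ k / of_nat k + (\<Sum>\<rho>\<in>#M. inverse \<rho> ^ k) * t ^ k / of_nat k)
        has_sum (- ln (1 - t / \<rho>) + - l)) {1..}"
      by (intro has_sum_add has_sum_log_one_minus n l)
    also have "(\<lambda>k. (t / \<rho>) ^ k / of_nat k + (\<Sum>\<rho>\<in>#M. inverse \<rho> ^ k) * t ^ k / of_nat k) =
        (\<lambda>k. (\<Sum>\<rho>\<in>#add_mset \<rho> M. inverse \<rho> ^ k) * t ^ k / of_nat k)"
      by (simp add: fun_eq_iff power_divide power_inverse divide_inverse algebra_simps)
    finally have "((\<lambda>k. (\<Sum>\<rho>\<in>#add_mset \<rho> M. inverse \<rho> ^ k) * t ^ k / of_nat k)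
        has_sum - (ln (1 - t / \<rho>) + l)) {1..}" by simp
    moreover have "1 - t / \<rho> \<noteq> 0" using n by auto
    hence "exp (ln (1 - t / \<rho>) + l) = poly (\<Prod>\<rho>\<in>#add_mset \<rho> M. [:1, - inverse \<rho>:]) t"
      by (simp add: exp_add l(2) field_simps)
    ultimately show ?case by blast
  qed
  moreover have "H \<noteq> 0" using H by auto
  hence "\<forall>\<rho>\<in>#proots H. norm (t / \<rho>) < 1" using small by auto
  ultimately have "\<exists>l. ((\<lambda>k. inv_root_power_sum H k * t ^ k / of_nat k) has_sum - l) {1..} \<and>
      exp l = poly (\<Prod>\<rho>\<in>#proots H. [:1, - inverse \<rho>:]) t"
    unfolding inv_root_power_sum_def by blast
  thus ?thesis using that poly_eq_prod_inverse_roots[OF H] by auto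
qed

lemma norm_inv_root_power_sum_le:
  assumes "\<And>\<rho>. poly H \<rho> = 0 \<Longrightarrow> 1 / norm \<rho> \<le> \<beta>"
  shows "norm (inv_root_power_sum H k) \<le> real (degree H) * \<beta> ^ k"
proof (cases "H = 0")
  case False
  have "norm (\<Sum>\<rho>\<in>#M. inverse \<rho> ^ k) \<le> real (size M) * \<beta> ^ k"
    if "\<forall>\<rho>\<in>#M. 1 / norm \<rho> \<le> \<beta>" for M :: "complex multiset"
    using that
  proof (induction M)
    case (add \<rho> M)
    have "norm (inverse \<rho> ^ k) \<le> \<beta> ^ k"
      using add.prems by (simp add: norm_power norm_inverse power_mono divide_inverse)
    thus ?case using add by (auto simp: algebra_simps intro!: norm_triangle_le)
  qed auto
  from this[of "proots H"] show ?thesis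
    using assms False by (simp add: inv_root_power_sum_def size_proots_complex)
qed (simp add: inv_root_power_sum_def)

lemma sum_power_le:
  fixes \<beta> :: real
  assumes "\<beta> \<ge> 2"
  shows "(\<Sum>i=1..n. \<beta> ^ i) \<le> 2 * \<beta> ^ n"
proof (induction n)
  case (Suc n)
  have "2 * \<beta> ^ n \<le> \<beta> ^ Suc n" using assms by simp
  thus ?case using Suc by simp
qed simp

text \<open>
  Bounding the divisor sum by the geometric sum over all \<open>d \<le> k\<close> costs only a factor 2, because
  \<open>\<beta> \<ge> 2\<close>.
\<close>

lemma norm_wcoeff_le:
  assumes "\<And>\<rho>. poly H \<rho> = 0 \<Longrightarrow> 1 / norm \<rho> \<le> \<beta>" and "\<beta> \<ge> 2" and "k > 0"
  shows "norm (wcoeff H k) \<le> 2 * real (degree H) * \<beta> ^ k / real k"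
proof -
  let ?s = "inv_root_power_sum H"
  have "norm (\<Sum>d | d dvd k. of_int (moebius (k div d)) * ?s d) \<le> (\<Sum>d | d dvd k. real (degree H) * \<beta> ^ d)"
  proof (rule sum_norm_le)
    fix d
    have "norm (of_int (moebius (k div d)) * ?s d) \<le> 1 * norm (?s d)"
      using abs_moebius_le_1[of "k div d"] unfolding norm_mult
      by (intro mult_right_mono) (simp_all flip: of_int_abs)
    thus "norm (of_int (moebius (k div d)) * ?s d) \<le> real (degree H) * \<beta> ^ d"
      using norm_inv_root_power_sum_le[of H \<beta> d, OF assms(1)] by simp
  qed
  also have "\<dots> \<le> (\<Sum>d=1..k. real (degree H) * \<beta> ^ d)"
    using assms by (intro sum_mono2) (auto intro: dvd_imp_le Suc_leI Nat.gr0I)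
  also have "\<dots> = real (degree H) * (\<Sum>d=1..k. \<beta> ^ d)" by (simp add: sum_distrib_left)
  also have "\<dots> \<le> real (degree H) * (2 * \<beta> ^ k)"
    by (intro mult_left_mono sum_power_le assms) auto
  finally show ?thesis using assms(3) by (simp add: wcoeff_def norm_mult norm_divide field_simps)
qed

section \<open>The truncated sums as power series at each prime\<close>

lemma has_sum_sum_family:
  fixes f :: "'i \<Rightarrow> 'a \<Rightarrow> 'b :: {topological_comm_monoid_add}"
  assumes "\<And>i. i \<in> I \<Longrightarrow> (f i has_sum S i) A"
  shows "((\<lambda>x. \<Sum>i\<in>I. f i x) has_sum (\<Sum>i\<in>I. S i)) A"
proof (cases "finite I")
  case True
  thus ?thesis using assms by (induction I) (auto intro!: has_sum_add)
qed simp

text \<open>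
  A power series in \<open>u ^ l\<close> read as a power series in \<open>u\<close>.
\<close>

lemma has_sum_dilate:
  fixes f :: "nat \<Rightarrow> 'b :: {comm_monoid_add, topological_space}"
  assumes "(f has_sum S) {1..}" and "l \<ge> 1"
  shows "((\<lambda>n. if l dvd n then f (n div l) else 0) has_sum S) {1..}"
proof -
  let ?g = "\<lambda>n. if l dvd n then f (n div l) else 0"
  have inj: "inj_on (\<lambda>k. l * k) {1..}" using assms(2) by (auto simp: inj_on_def)
  have "?g \<circ> (\<lambda>k. l * k) = f" using assms(2) by (auto simp: fun_eq_iff)
  hence "(?g has_sum S) ((\<lambda>k. l * k) ` {1..})"
    using assms(1) by (simp only: has_sum_reindex[OF inj])
  moreover have "(?g has_sum S) ((\<lambda>k. l * k) ` {1..}) \<longleftrightarrow> (?g has_sum S) {1..}"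
  proof (rule has_sum_cong_neutral)
    fix n assume n: "n \<in> {1..} - (\<lambda>k. l * k) ` {1..}"
    have "\<not> l dvd n"
    proof
      assume "l dvd n"
      then obtain k where "n = l * k" by blast
      moreover have "k \<ge> 1" using n calculation by (cases k) auto
      ultimately show False using n by auto
    qed
    thus "?g n = 0" by simp
  qed (use assms(2) in auto)
  ultimately show ?thesis by simp
qed

text \<open>
  The coefficient of \<open>u ^ m\<close> in \<open>\<Sum>l\<le>L. (1 / l) (\<Sum>d | d dvd l. \<mu> d (\<Sum>k. \<theta> (d * k) u ^ (k * l) / k))\<close>.
  For the application, \<open>\<theta> e\<close> is the indicator of \<open>p ^ e \<equiv> a\<close> modulo \<open>q\<close> and \<open>u = 1 / p ^ j\<close>.
\<close>

definition truncated_coeff :: "(nat \<Rightarrow> complex) \<Rightarrow> nat \<Rightarrow> nat \<Rightarrow> complex" where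
  "truncated_coeff \<theta> L m =
     1 / of_nat m * (\<Sum>l | l dvd m \<and> l \<le> L. \<Sum>d | d dvd l. of_int (moebius d) * \<theta> (d * (m div l)))"

text \<open>
  As \<open>m \<le> L\<close>, no divisor \<open>l\<close> of \<open>m\<close> is cut off.  Grouping the terms by \<open>k = l div d\<close>, so that the
  argument of \<open>\<theta>\<close> is \<open>m div k\<close>, leaves the full Moebius sum over the divisors of \<open>m div k\<close>, which
  vanishes unless \<open>k = m\<close>.
\<close>

lemma truncated_coeff_eq:
  assumes "0 < m" "m \<le> L"
  shows "truncated_coeff \<theta> L m = \<theta> 1 / of_nat m"
proof -
  let ?f = "\<lambda>k e. of_int (moebius e) * \<theta> (m div k)"
  have pos: "d > 0" if "d dvd m" for d using that assms(1) by (auto intro: Nat.gr0I)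
  have "{l. l dvd m \<and> l \<le> L} = {l. l dvd m}"
    using assms by (auto dest: dvd_imp_le)
  hence "(\<Sum>l | l dvd m \<and> l \<le> L. \<Sum>d | d dvd l. of_int (moebius d) * \<theta> (d * (m div l))) =
      (\<Sum>l | l dvd m. \<Sum>d | d dvd l. of_int (moebius d) * \<theta> (d * (m div l)))" by simp
  also have "\<dots> = (\<Sum>l | l dvd m. \<Sum>k | k dvd l. ?f k (l div k))"
  proof (rule sum.cong[OF refl], clarify)
    fix l assume l: "l dvd m"
    have ll: "l > 0" using pos[OF l] .
    show "(\<Sum>d | d dvd l. of_int (moebius d) * \<theta> (d * (m div l))) = (\<Sum>k | k dvd l. ?f k (l div k))"
    proof (rule sum.reindex_bij_witness[of _ "\<lambda>k. l div k" "\<lambda>d. l div d"])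
      fix d assume "d \<in> {d. d dvd l}"
      then obtain c where c: "l = d * c" by auto
      obtain b where b: "m = l * b" using l by blast
      have "c > 0" "d > 0" using ll c by auto
      thus "?f (l div d) (l div (l div d)) = of_int (moebius d) * \<theta> (d * (m div l))"
        "l div (l div d) = d" "l div d \<in> {k. k dvd l}"
        by (simp_all add: b c mult.assoc mult.left_commute[of d c])
    next
      fix k assume "k \<in> {k. k dvd l}"
      then obtain c where c: "l = k * c" by auto
      have "c > 0" "k > 0" using ll c by auto
      thus "l div (l div k) = k" "l div k \<in> {d. d dvd l}" by (simp_all add: c)
    qed
  qed
  also have "\<dots> = (\<Sum>k | k dvd m. \<Sum>e | e dvd m div k. ?f k e)"
    by (rule sum_divisors_of_divisors[OF assms(1)])
  also have "\<dots> = (\<Sum>k | k dvd m. if k = m then \<theta> 1 else 0)"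
  proof (rule sum.cong[OF refl], clarify)
    fix k assume k: "k dvd m"
    have "(\<Sum>e | e dvd m div k. ?f k e) = of_int (\<Sum>e | e dvd m div k. moebius e) * \<theta> (m div k)"
      by (simp add: sum_distrib_right)
    also have "(\<Sum>e | e dvd m div k. moebius e) = of_bool (m div k = 1)"
      using k assms(1) by (intro sum_moebius_divisors) (auto simp: dvd_div_eq_0_iff intro!: Nat.gr0I)
    also have "m div k = 1 \<longleftrightarrow> k = m" using k assms(1) by (auto elim!: dvdE)
    finally show "(\<Sum>e | e dvd m div k. ?f k e) = (if k = m then \<theta> 1 else 0)"
      using assms(1) by simp
  qed
  also have "\<dots> = \<theta> 1" using assms(1) by simp
  finally show ?thesis by (simp add: truncated_coeff_def)
qed

lemma card_divisors_le: "card {d. d dvd n} \<le> n" if "n > 0" for n :: nat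
proof -
  have "{d. d dvd n} \<subseteq> {1..n}" using that by (auto dest: dvd_imp_le intro!: Suc_leI Nat.gr0I)
  from card_mono[OF _ this] show ?thesis by simp
qed

text \<open>
  The bound is crude (there are at most \<open>m\<close> divisors \<open>l\<close>, each with at most \<open>m\<close> terms), but it only
  matters for \<open>m > L\<close>, where powers of \<open>\<beta>\<close> dominate it.
\<close>

lemma norm_truncated_coeff_le:
  assumes "\<And>e. norm (\<theta> e) \<le> 1"
  shows "norm (truncated_coeff \<theta> L m) \<le> real m"
proof (cases "m = 0")
  case False
  have inner: "norm (\<Sum>d | d dvd l. of_int (moebius d) * \<theta> (d * (m div l))) \<le> real m" if "l dvd m" for l
  proof -
    have "l > 0" "l \<le> m" using that False by (auto dest: dvd_imp_le intro: Nat.gr0I)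
    have "norm (\<Sum>d | d dvd l. of_int (moebius d) * \<theta> (d * (m div l))) \<le> (\<Sum>d | d dvd l. 1)"
    proof (rule sum_norm_le)
      fix d
      have "\<bar>of_int (moebius d) :: real\<bar> \<le> 1" using abs_moebius_le_1[of d] by linarith
      thus "norm (of_int (moebius d) * \<theta> (d * (m div l))) \<le> 1"
        using assms by (simp add: norm_mult mult_le_one)
    qed
    also have "\<dots> \<le> real l" using card_divisors_le[OF \<open>l > 0\<close>] by simp
    finally show ?thesis using \<open>l \<le> m\<close> by simp
  qed
  have "norm (\<Sum>l | l dvd m \<and> l \<le> L. \<Sum>d | d dvd l. of_int (moebius d) * \<theta> (d * (m div l)))
      \<le> (\<Sum>l | l dvd m \<and> l \<le> L. real m)"
    by (rule sum_norm_le) (use inner in auto)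
  also have "\<dots> \<le> (\<Sum>l | l dvd m. real m)"
    using False by (intro sum_mono2) auto
  also have "\<dots> \<le> real m * real m"
    using card_divisors_le[of m] False by (simp add: mult_right_mono)
  finally show ?thesis
    using False by (simp add: truncated_coeff_def norm_mult norm_divide field_simps)
qed (simp add: truncated_coeff_def)

definition truncated_value :: "(nat \<Rightarrow> complex) \<Rightarrow> nat \<Rightarrow> complex \<Rightarrow> complex" where
  "truncated_value \<theta> L u =
     (\<Sum>l = 1..L. 1 / of_nat l * (\<Sum>d | d dvd l. of_int (moebius d) *
        (\<Sum>\<^sub>\<infinity>k\<in>{1..}. \<theta> (d * k) / of_nat k * u ^ (k * l))))"

lemma
  fixes u :: complex
  assumes \<theta>: "\<And>e. norm (\<theta> e) \<le> 1" and u: "norm u \<le> 1 / 2" and l: "l \<ge> 1"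
  shows summable_on_log_series: "(\<lambda>k. \<theta> (d * k) / of_nat k * u ^ (k * l)) summable_on {1..}"
    and norm_infsum_log_series_le: "norm (\<Sum>\<^sub>\<infinity>k\<in>{1..}. \<theta> (d * k) / of_nat k * u ^ (k * l)) \<le> 2 * norm u"
proof -
  let ?f = "\<lambda>k. \<theta> (d * k) / of_nat k * u ^ (k * l)"
  have le: "norm (?f k) \<le> norm u ^ k" if "k \<in> {1..}" for k
  proof -
    have "norm (\<theta> (d * k) / of_nat k) \<le> 1"
      using \<theta>[of "d * k"] that by (simp add: norm_divide divide_le_eq)
    moreover have "norm (u ^ (k * l)) \<le> norm u ^ k"
      using u l by (simp add: norm_power power_decreasing)
    ultimately have "norm (?f k) \<le> 1 * norm u ^ k"
      unfolding norm_mult by (intro mult_mono) auto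
    thus ?thesis by simp
  qed
  have geo: "((\<lambda>k. norm u ^ k) has_sum (norm u / (1 - norm u))) {1..}"
    using u has_sum_geometric_from_1[of "norm u"] by simp
  show sm: "?f summable_on {1..}"
    by (rule abs_summable_summable,
        rule Infinite_Sum.abs_summable_on_comparison_test'[OF has_sum_imp_summable[OF geo] le])
  have "norm (infsum ?f {1..}) \<le> norm u / (1 - norm u)"
    by (rule norm_infsum_le[OF has_sum_infsum[OF sm] geo le])
  also have "\<dots> \<le> norm u / (1 / 2)"
    using u by (intro divide_left_mono) auto
  finally show "norm (infsum ?f {1..}) \<le> 2 * norm u" by simp
qed

lemma has_sum_truncated_value:
  assumes \<theta>: "\<And>e. norm (\<theta> e) \<le> 1" and u: "norm u \<le> 1 / 2"
  shows "((\<lambda>m. truncated_coeff \<theta> L m * u ^ m) has_sum truncated_value \<theta> L u) {1..}"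
proof -
  let ?t = "\<lambda>d l k. \<theta> (d * k) / of_nat k * u ^ (k * l)"
  have "((\<lambda>m. \<Sum>l = 1..L. 1 / of_nat l * (\<Sum>d | d dvd l. of_int (moebius d) *
        (if l dvd m then ?t d l (m div l) else 0))) has_sum truncated_value \<theta> L u) {1..}"
    unfolding truncated_value_def
  proof (rule has_sum_sum_family, rule has_sum_cmult_right, rule has_sum_sum_family, rule has_sum_cmult_right)
    fix l d assume "l \<in> {1..L}"
    hence l: "l \<ge> 1" by simp
    show "((\<lambda>m. if l dvd m then ?t d l (m div l) else 0) has_sum (\<Sum>\<^sub>\<infinity>k\<in>{1..}. ?t d l k)) {1..}"
      using has_sum_dilate[OF has_sum_infsum[OF summable_on_log_series[of \<theta> u l d]] l] \<theta> u l
      by simp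
  qed
  also have "?this \<longleftrightarrow> ?thesis"
  proof (rule has_sum_cong)
    fix m :: nat assume m: "m \<in> {1..}"
    have "(\<Sum>l = 1..L. 1 / of_nat l * (\<Sum>d | d dvd l. of_int (moebius d) *
        (if l dvd m then ?t d l (m div l) else 0))) =
      (\<Sum>l | l dvd m \<and> l \<le> L. 1 / of_nat l * (\<Sum>d | d dvd l. of_int (moebius d) * ?t d l (m div l)))"
    proof (rule sum.mono_neutral_cong_right)
      show "{l. l dvd m \<and> l \<le> L} \<subseteq> {1..L}" using m by (auto intro!: Suc_leI Nat.gr0I)
      show "\<forall>l\<in>{1..L} - {l. l dvd m \<and> l \<le> L}. 1 / of_nat l * (\<Sum>d | d dvd l. of_int (moebius d) *
        (if l dvd m then ?t d l (m div l) else 0)) = 0"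
      proof
        fix l assume "l \<in> {1..L} - {l. l dvd m \<and> l \<le> L}"
        hence "\<not> l dvd m" by auto
        thus "1 / of_nat l * (\<Sum>d | d dvd l. of_int (moebius d) *
          (if l dvd m then ?t d l (m div l) else 0)) = 0" by simp
      qed
    qed simp_all
    also have "\<dots> = (\<Sum>l | l dvd m \<and> l \<le> L. 1 / of_nat m * u ^ m *
        (\<Sum>d | d dvd l. of_int (moebius d) * \<theta> (d * (m div l))))"
    proof (rule sum.cong[OF refl], clarify)
      fix l assume "l dvd m"
      then obtain k where k: "m = l * k" by blast
      have "l * k > 0" using m k by simp
      hence "l > 0" "k > 0" by simp_all
      hence "1 / of_nat l * (c * ?t d l (m div l)) = 1 / of_nat m * u ^ m * (c * \<theta> (d * (m div l)))" for c d
        by (simp add: k mult.commute[of k l])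
      thus "1 / of_nat l * (\<Sum>d | d dvd l. of_int (moebius d) * ?t d l (m div l)) =
          1 / of_nat m * u ^ m * (\<Sum>d | d dvd l. of_int (moebius d) * \<theta> (d * (m div l)))"
        unfolding sum_distrib_left by (intro sum.cong refl)
    qed
    also have "\<dots> = truncated_coeff \<theta> L m * u ^ m"
      unfolding truncated_coeff_def sum_distrib_left[symmetric] by (simp only: mult_ac)
    finally show "(\<Sum>l = 1..L. 1 / of_nat l * (\<Sum>d | d dvd l. of_int (moebius d) *
        (if l dvd m then ?t d l (m div l) else 0))) = truncated_coeff \<theta> L m * u ^ m" .
  qed
  finally show ?thesis .
qed

text \<open>
  Telescoping, from \<open>1 / n ^ 2 \<le> 1 / (n - 1) - 1 / n\<close>.
\<close>

lemma sum_inverse_squares_le: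
  assumes "P \<ge> 2" "finite F" "F \<subseteq> {P..}"
  shows "(\<Sum>n\<in>F. 1 / real n ^ 2) \<le> 1 / (real P - 1)"
proof -
  have "(\<Sum>n = P..<P + k. 1 / real n ^ 2) \<le> 1 / (real P - 1) - 1 / (real (P + k) - 1)" for k
  proof (induction k)
    case (Suc k)
    define x where "x = real (P + k)"
    have x: "x \<ge> 2" using assms(1) by (simp add: x_def)
    have "1 / x ^ 2 \<le> 1 / (x - 1) - 1 / x"
      using x by (simp add: field_simps power2_eq_square)
    moreover have "real (P + Suc k) - 1 = x" by (simp add: x_def)
    ultimately show ?case using Suc unfolding x_def by simp
  qed simp
  note * = this
  obtain M where M: "\<forall>n\<in>F. n < M" using assms(2) finite_nat_set_iff_bounded by blast
  have "(\<Sum>n\<in>F. 1 / real n ^ 2) \<le> (\<Sum>n = P..<P + M. 1 / real n ^ 2)"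
    using assms M by (intro sum_mono2) force+
  also have "\<dots> \<le> 1 / (real P - 1) - 1 / (real (P + M) - 1)" by (rule *)
  also have "\<dots> \<le> 1 / (real P - 1)" using assms(1) by simp
  finally show ?thesis .
qed

lemma summable_on_inverse_squares: "(\<lambda>n. 1 / real n ^ 2) summable_on {P..}" if "P \<ge> 2"
proof (rule nonneg_bdd_above_summable_on)
  show "bdd_above (sum (\<lambda>n. 1 / real n ^ 2) ` {F. F \<subseteq> {P..} \<and> finite F})"
  proof (rule bdd_aboveI2)
    fix F assume "F \<in> {F. F \<subseteq> {P..} \<and> finite F}"
    thus "(\<Sum>n\<in>F. 1 / real n ^ 2) \<le> 1 / (real P - 1)"
      using sum_inverse_squares_le[OF that] by blast
  qed
qed simp

text \<open>
  For each \<open>l\<close>, \<open>d\<close> and each prime \<open>p\<close>, the average over the characters is taken inside the series over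
  \<open>k\<close>, where orthogonality turns \<open>\<psi> (p ^ (d * k))\<close> into an indicator.  As \<open>j \<ge> 2\<close>, each
  such series is at most \<open>2 / p ^ 2\<close>, so that its sum over the primes converges and the finite
  sums over \<open>l\<close>, \<open>d\<close> and the characters can be moved inside.
\<close>

lemma has_sum_Y_sum:
  assumes q: "q \<ge> 1" and a: "coprime a (int q)" and P: "P \<ge> 2" and j: "j \<ge> 2"
  shows "((\<lambda>p. truncated_value (\<lambda>e. of_bool ([int p ^ e = a] (mod int q))) L ((1 / of_nat p) ^ j))
    has_sum Y_sum P (of_nat j) q a L) {p. prime p \<and> P \<le> p}"
proof -
  let ?A = "{p. prime p \<and> P \<le> p}" and ?D = "dirichlet_characters q"
  define u :: "nat \<Rightarrow> complex" where "u p = (1 / of_nat p) ^ j" for p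
  have u: "norm (u p) \<le> 1 / real p ^ 2" "norm (u p) \<le> 1 / 2" if "p \<in> ?A" for p
  proof -
    have p: "real p \<ge> 2" using that P by simp
    have "(1 / real p) ^ j \<le> (1 / real p) ^ 2"
      using p j by (intro power_decreasing) auto
    thus "norm (u p) \<le> 1 / real p ^ 2"
      by (simp add: u_def norm_power norm_divide power_divide)
    also have "\<dots> \<le> 1 / 2 ^ 2"
      using p by (intro divide_left_mono power_mono) auto
    finally show "norm (u p) \<le> 1 / 2" by simp
  qed
  define g where "g d l \<psi> p = (\<Sum>\<^sub>\<infinity>k\<in>{1..}. \<psi> (int p) ^ (d * k) / of_nat k * u p ^ (k * l))"
    for d l and \<psi> :: "int \<Rightarrow> complex" and p
  have \<psi>1: "norm (\<psi> n ^ e) \<le> 1" if "\<psi> \<in> ?D" for \<psi> n e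
    using norm_dirichlet_character_le_1[OF q that] by (simp add: norm_power power_le_one)
  have log: "(g d l \<psi> has_sum log_L P (of_nat l * of_nat j) (\<lambda>n. \<psi> n ^ d)) ?A"
    if l: "l \<ge> 1" and \<psi>: "\<psi> \<in> ?D" for d l \<psi>
  proof -
    have term_eq: "(\<psi> (int p) ^ d) ^ k / (of_nat k * of_nat p powr (of_nat k * (of_nat l * of_nat j))) =
        \<psi> (int p) ^ (d * k) / of_nat k * u p ^ (k * l)" if "p \<in> ?A" for p k
    proof -
      have "p \<noteq> 0" using that P by auto
      hence "(of_nat p :: complex) powr (of_nat k * (of_nat l * of_nat j)) = of_nat p ^ (k * l * j)"
        using powr_nat'[of "of_nat p" "k * l * j"] by (simp add: mult.assoc)
      thus ?thesis
        by (simp add: u_def power_divide mult_ac flip: power_mult)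
    qed
    have "log_L P (of_nat l * of_nat j) (\<lambda>n. \<psi> n ^ d) = infsum (g d l \<psi>) ?A"
      unfolding log_L_def g_def by (intro infsum_cong term_eq)
    moreover have "g d l \<psi> summable_on ?A"
    proof (rule abs_summable_summable, rule Infinite_Sum.abs_summable_on_comparison_test')
      show "(\<lambda>p. 2 * (1 / real p ^ 2)) summable_on ?A"
        by (intro summable_on_cmult_right summable_on_subset[OF summable_on_inverse_squares[OF P]]) auto
      fix p assume p: "p \<in> ?A"
      have "norm (g d l \<psi> p) \<le> 2 * norm (u p)"
        unfolding g_def
        by (rule norm_infsum_log_series_le[where \<theta> = "\<lambda>e. \<psi> (int p) ^ e"])
          (use \<psi>1[OF \<psi>] u(2)[OF p] l in auto)
      also have "\<dots> \<le> 2 * (1 / real p ^ 2)" using u(1)[OF p] by simp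
      finally show "norm (g d l \<psi> p) \<le> 2 * (1 / real p ^ 2)" .
    qed
    ultimately show ?thesis by (simp add: has_sum_infsum)
  qed
  have "((\<lambda>p. \<Sum>l = 1..L. 1 / of_nat l * (\<Sum>d | d dvd l. of_int (moebius d) *
        (\<Sum>\<psi>\<in>?D. cnj (\<psi> a) / of_nat (totient q) * g d l \<psi> p))) has_sum Y_sum P (of_nat j) q a L) ?A"
    unfolding Y_sum_def
    by (intro has_sum_sum_family has_sum_cmult_right log) auto
  also have "?this \<longleftrightarrow> ?thesis"
  proof (rule has_sum_cong)
    fix p assume p: "p \<in> ?A"
    let ?\<theta> = "\<lambda>e. of_bool ([int p ^ e = a] (mod int q)) :: complex"
    have "(\<Sum>\<psi>\<in>?D. cnj (\<psi> a) / of_nat (totient q) * g d l \<psi> p) =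
        (\<Sum>\<^sub>\<infinity>k\<in>{1..}. ?\<theta> (d * k) / of_nat k * u p ^ (k * l))" if l: "l \<ge> 1" for d l
    proof (rule infsumI[symmetric])
      have "((\<lambda>k. \<Sum>\<psi>\<in>?D. cnj (\<psi> a) / of_nat (totient q) *
            (\<psi> (int p) ^ (d * k) / of_nat k * u p ^ (k * l)))
          has_sum (\<Sum>\<psi>\<in>?D. cnj (\<psi> a) / of_nat (totient q) * g d l \<psi> p)) {1..}"
        unfolding g_def
        by (intro has_sum_sum_family has_sum_cmult_right has_sum_infsum
            summable_on_log_series[where \<theta> = "\<lambda>e. \<psi> (int p) ^ e" for \<psi>])
          (use \<psi>1 u(2)[OF p] l in auto)
      also have "(\<lambda>k. \<Sum>\<psi>\<in>?D. cnj (\<psi> a) / of_nat (totient q) *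
            (\<psi> (int p) ^ (d * k) / of_nat k * u p ^ (k * l))) =
          (\<lambda>k. ?\<theta> (d * k) / of_nat k * u p ^ (k * l))"
      proof
        fix k
        have "(\<Sum>\<psi>\<in>?D. cnj (\<psi> a) / of_nat (totient q) *
            (\<psi> (int p) ^ (d * k) / of_nat k * u p ^ (k * l))) =
          (\<Sum>\<psi>\<in>?D. cnj (\<psi> a) / of_nat (totient q) * \<psi> (int p ^ (d * k)) *
            (1 / of_nat k * u p ^ (k * l)))"
          by (intro sum.cong refl) (simp add: dirichlet_character_power[OF q])
        also have "\<dots> = ?\<theta> (d * k) * (1 / of_nat k * u p ^ (k * l))"
          unfolding sum_distrib_right[symmetric] dirichlet_character_orthogonality[OF q a] ..
        finally show "(\<Sum>\<psi>\<in>?D. cnj (\<psi> a) / of_nat (totient q) *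
            (\<psi> (int p) ^ (d * k) / of_nat k * u p ^ (k * l))) = ?\<theta> (d * k) / of_nat k * u p ^ (k * l)"
          by simp
      qed
      finally show "((\<lambda>k. ?\<theta> (d * k) / of_nat k * u p ^ (k * l)) has_sum
          (\<Sum>\<psi>\<in>?D. cnj (\<psi> a) / of_nat (totient q) * g d l \<psi> p)) {1..}" .
    qed
    note char = this
    show "(\<Sum>l = 1..L. 1 / of_nat l * (\<Sum>d | d dvd l. of_int (moebius d) *
        (\<Sum>\<psi>\<in>?D. cnj (\<psi> a) / of_nat (totient q) * g d l \<psi> p))) =
        truncated_value ?\<theta> L ((1 / of_nat p) ^ j)"
      unfolding truncated_value_def u_def[symmetric]
    proof (rule sum.cong[OF refl])
      fix l assume "l \<in> {1..L}"
      hence l: "l \<ge> 1" by simp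
      show "1 / of_nat l * (\<Sum>d | d dvd l. of_int (moebius d) *
          (\<Sum>\<psi>\<in>?D. cnj (\<psi> a) / of_nat (totient q) * g d l \<psi> p)) =
        1 / of_nat l * (\<Sum>d | d dvd l. of_int (moebius d) *
          (\<Sum>\<^sub>\<infinity>k\<in>{1..}. ?\<theta> (d * k) / of_nat k * u p ^ (k * l)))"
        unfolding char[OF l] ..
    qed
  qed
  finally show ?thesis .
qed

section \<open>The error at one prime\<close>

lemma has_sum_geometric_tail:
  fixes r :: real
  assumes "\<bar>r\<bar> < 1"
  shows "((\<lambda>n. r ^ n) has_sum (r ^ Suc N / (1 - r))) {Suc N..}"
proof -
  have img: "(\<lambda>k. k + N) ` {1..} = {Suc N..}"
  proof (intro equalityI subsetI)
    fix n assume "n \<in> {Suc N..}"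
    thus "n \<in> (\<lambda>k. k + N) ` {1..}" by (intro image_eqI[of _ _ "n - N"]) auto
  qed auto
  have "((\<lambda>k. r ^ N * r ^ k) has_sum (r ^ N * (r / (1 - r)))) {1..}"
    using assms by (intro has_sum_cmult_right has_sum_geometric_from_1) simp
  hence "(((\<lambda>n. r ^ n) \<circ> (\<lambda>k. k + N)) has_sum (r ^ Suc N / (1 - r))) {1..}"
    by (simp add: o_def power_add mult_ac)
  hence "((\<lambda>n. r ^ n) has_sum (r ^ Suc N / (1 - r))) ((\<lambda>k. k + N) ` {1..})"
    by (subst has_sum_reindex) auto
  thus ?thesis unfolding img .
qed

text \<open>
  Proper divisors of \<open>n\<close> are at most \<open>n div 2\<close>; this absorbs the factor \<open>n\<close> that they carry.
\<close>

lemma of_nat_le_two_times_power: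
  fixes \<beta> :: real
  assumes "\<beta> \<ge> 2"
  shows "real n * \<beta> ^ (n div 2) \<le> 2 * \<beta> ^ n"
proof -
  define k where "k = n - n div 2"
  have n: "n = n div 2 + k" by (simp add: k_def)
  have "real n \<le> 2 * real k" unfolding k_def by linarith
  also have "real k \<le> 2 ^ k" using less_exp[of k] by (metis less_imp_le of_nat_le_iff of_nat_numeral of_nat_power)
  also have "(2::real) ^ k \<le> \<beta> ^ k" using assms by (intro power_mono) auto
  finally have "real n * \<beta> ^ (n div 2) \<le> (2 * \<beta> ^ k) * \<beta> ^ (n div 2)"
    using assms by (intro mult_right_mono) auto
  also have "\<dots> = 2 * \<beta> ^ n" using n by (metis mult.assoc mult.commute power_add)
  finally show ?thesis .
qed

text \<open>
  Expand everything in powers of \<open>x\<close>, with coefficients \<open>e n\<close>.  For \<open>n \<le> 2 * L\<close> the truncation is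
  invisible and \<open>e n = 0\<close> is the relation \<open>conv\<close> between \<open>s\<close> and \<open>\<Delta>\<close>
  (the missing term \<open>j = 1\<close> is zero).  For \<open>n > 2 * L\<close> the indices
  \<open>j \<le> 2 * L\<close> dividing \<open>n\<close> are proper divisors, so \<open>\<beta> ^ j\<close> is at most \<open>\<beta> ^ (n div 2)\<close> and the
  sum over \<open>j\<close> stays within \<open>4 * D * \<beta> ^ n\<close>.
\<close>

lemma norm_truncation_error_le:
  fixes x lam :: complex and \<Delta> s \<theta> :: "nat \<Rightarrow> complex" and \<beta> D :: real
  assumes \<beta>: "\<beta> \<ge> 2" and x: "\<beta> * norm x \<le> 1 / 2" and D: "D \<ge> 0"
    and \<theta>: "\<And>e. norm (\<theta> e) \<le> 1"
    and \<Delta>1: "\<Delta> 1 = 0"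
    and conv: "\<And>n. n > 0 \<Longrightarrow> (\<Sum>d | d dvd n. of_nat d * \<Delta> d) = s n"
    and \<Delta>_le: "\<And>j. j > 0 \<Longrightarrow> norm (\<Delta> j) \<le> 4 * D * \<beta> ^ j / real j"
    and s_le: "\<And>n. norm (s n) \<le> 2 * D * \<beta> ^ n"
    and lam: "((\<lambda>n. s n * x ^ n / of_nat n) has_sum - lam) {1..}"
  shows "norm (\<theta> 1 * lam + (\<Sum>j = 2..2 * L. \<Delta> j * truncated_value \<theta> L (x ^ j)))
    \<le> 12 * D * (\<beta> * norm x) ^ Suc (2 * L)"
proof -
  define e where "e n = - \<theta> 1 * (s n / of_nat n) +
    (\<Sum>j = 2..2 * L. if j dvd n then \<Delta> j * truncated_coeff \<theta> L (n div j) else 0)" for n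
  let ?S = "\<theta> 1 * lam + (\<Sum>j = 2..2 * L. \<Delta> j * truncated_value \<theta> L (x ^ j))"
  define r where "r = \<beta> * norm x"
  have r: "0 \<le> r" "r \<le> 1 / 2" using x \<beta> by (auto simp: r_def)
  have "2 * norm x \<le> \<beta> * norm x" using \<beta> by (intro mult_right_mono) auto
  hence x12: "norm x \<le> 1 / 2" using x by linarith
  have xj: "norm (x ^ j) \<le> 1 / 2" if "j \<ge> 1" for j
    using power_decreasing[of 1 j "norm x"] that x12 by (simp add: norm_power)
  have dil: "((\<lambda>n. if j dvd n then truncated_coeff \<theta> L (n div j) * (x ^ j) ^ (n div j) else 0)
      has_sum truncated_value \<theta> L (x ^ j)) {1..}" if j: "j \<ge> 1" for j
    using has_sum_dilate[OF has_sum_truncated_value[where \<theta> = \<theta> and L = L and u = "x ^ j"] j] \<theta> xj[OF j]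
    by blast
  have "((\<lambda>n. - \<theta> 1 * (s n * x ^ n / of_nat n) + (\<Sum>j = 2..2 * L. \<Delta> j *
        (if j dvd n then truncated_coeff \<theta> L (n div j) * (x ^ j) ^ (n div j) else 0)))
      has_sum (- \<theta> 1 * - lam + (\<Sum>j = 2..2 * L. \<Delta> j * truncated_value \<theta> L (x ^ j)))) {1..}"
  proof (rule has_sum_add)
    show "((\<lambda>n. - \<theta> 1 * (s n * x ^ n / of_nat n)) has_sum (- \<theta> 1 * - lam)) {1..}"
      using lam by (rule has_sum_cmult_right)
    show "((\<lambda>n. \<Sum>j = 2..2 * L. \<Delta> j *
        (if j dvd n then truncated_coeff \<theta> L (n div j) * (x ^ j) ^ (n div j) else 0))
      has_sum (\<Sum>j = 2..2 * L. \<Delta> j * truncated_value \<theta> L (x ^ j))) {1..}"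
      by (rule has_sum_sum_family, rule has_sum_cmult_right, rule dil) simp
  qed
  also have "(\<lambda>n. - \<theta> 1 * (s n * x ^ n / of_nat n) + (\<Sum>j = 2..2 * L. \<Delta> j *
        (if j dvd n then truncated_coeff \<theta> L (n div j) * (x ^ j) ^ (n div j) else 0))) =
      (\<lambda>n. e n * x ^ n)"
  proof
    fix n
    have "\<Delta> j * (if j dvd n then truncated_coeff \<theta> L (n div j) * (x ^ j) ^ (n div j) else 0) =
        (if j dvd n then \<Delta> j * truncated_coeff \<theta> L (n div j) else 0) * x ^ n" for j
      by (simp flip: power_mult)
    thus "- \<theta> 1 * (s n * x ^ n / of_nat n) + (\<Sum>j = 2..2 * L. \<Delta> j *
        (if j dvd n then truncated_coeff \<theta> L (n div j) * (x ^ j) ^ (n div j) else 0)) = e n * x ^ n"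
      unfolding e_def distrib_right sum_distrib_right by simp
  qed
  finally have sum1: "((\<lambda>n. e n * x ^ n) has_sum ?S) {1..}" by simp

  have e0: "e n = 0" if n: "n > 0" "n \<le> 2 * L" for n
  proof -
    have "(\<Sum>j = 2..2 * L. if j dvd n then \<Delta> j * truncated_coeff \<theta> L (n div j) else 0) =
        (\<Sum>j | j dvd n. \<theta> 1 / of_nat n * (of_nat j * \<Delta> j))"
    proof (rule sum.mono_neutral_cong)
      fix j assume "j \<in> {2..2 * L} \<inter> {j. j dvd n}"
      then obtain k where k: "n = j * k" and j: "j \<ge> 2" by auto
      have "k > 0" using n(1) k by (cases k) auto
      moreover have "k \<le> L"
      proof -
        have "2 * k \<le> 2 * L" using n(2) mult_le_mono1[OF j, of k] k by linarith
        thus ?thesis by simp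
      qed
      ultimately have "truncated_coeff \<theta> L k = \<theta> 1 / of_nat k" by (rule truncated_coeff_eq)
      thus "(if j dvd n then \<Delta> j * truncated_coeff \<theta> L (n div j) else 0) =
          \<theta> 1 / of_nat n * (of_nat j * \<Delta> j)"
        using j k by simp
    next
      fix j assume "j \<in> {j. j dvd n} - {2..2 * L}"
      hence "j dvd n" "\<not> (2 \<le> j \<and> j \<le> 2 * L)" by auto
      moreover have "j \<le> 2 * L" "j \<noteq> 0" using \<open>j dvd n\<close> n dvd_imp_le[of j n] by auto
      ultimately have "j = 1" by linarith
      thus "\<theta> 1 / of_nat n * (of_nat j * \<Delta> j) = 0" using \<Delta>1 by simp
    qed (use n(1) in auto)
    also have "\<dots> = \<theta> 1 / of_nat n * s n"
      using conv[OF n(1)] by (simp only: sum_distrib_left[symmetric])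
    finally show ?thesis by (simp add: e_def)
  qed

  have e_le: "norm (e n) \<le> 6 * D * \<beta> ^ n" if n: "n > 2 * L" for n
  proof -
    have n0: "n > 0" using n by simp
    have \<beta>0: "\<beta> ^ n \<ge> 0" using \<beta> by simp
    have "norm (\<theta> 1 * (s n / of_nat n)) \<le> 1 * (2 * D * \<beta> ^ n / 1)"
      unfolding norm_mult norm_divide
      using \<theta> s_le[of n] n0 D \<beta>0 by (intro mult_mono frac_le) auto
    hence first: "norm (- \<theta> 1 * (s n / of_nat n)) \<le> 2 * D * \<beta> ^ n" by simp
    have "norm (\<Sum>j = 2..2 * L. if j dvd n then \<Delta> j * truncated_coeff \<theta> L (n div j) else 0) \<le>
        (\<Sum>j = 2..2 * L. if j \<le> n div 2 then D * real n * \<beta> ^ j else 0)"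
    proof (rule sum_norm_le)
      fix j assume j: "j \<in> {2..2 * L}"
      show "norm (if j dvd n then \<Delta> j * truncated_coeff \<theta> L (n div j) else 0) \<le>
          (if j \<le> n div 2 then D * real n * \<beta> ^ j else 0)"
      proof (cases "j dvd n")
        case True
        then obtain k where k: "n = j * k" by blast
        have "k \<ge> 2"
        proof (rule ccontr)
          assume "\<not> k \<ge> 2"
          hence "k = 0 \<or> k = 1" by linarith
          thus False using n j k by auto
        qed
        hence "j * 2 \<le> n" unfolding k by (rule mult_le_mono2)
        hence jn: "j \<le> n div 2" by linarith
        have "norm (\<Delta> j * truncated_coeff \<theta> L k) \<le> (4 * D * \<beta> ^ j / real j) * real k"
          unfolding norm_mult
          using \<Delta>_le[of j] norm_truncated_coeff_le[of \<theta> L k] \<theta> j D \<beta> by (intro mult_mono) auto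
        also have "\<dots> = D * \<beta> ^ j * (4 * real k / real j)" by simp
        also have "4 * real k / real j \<le> real n"
        proof -
          have "2 * 2 \<le> real j * real j" using j by (intro mult_mono) auto
          hence "4 * real k \<le> real j * real j * real k" by (intro mult_right_mono) auto
          thus ?thesis using j by (simp add: k divide_le_eq mult_ac)
        qed
        hence "D * \<beta> ^ j * (4 * real k / real j) \<le> D * \<beta> ^ j * real n"
          using D \<beta> by (intro mult_left_mono) auto
        finally show ?thesis using True jn j by (simp add: k mult_ac)
      next
        case False
        have "0 \<le> D * real n * \<beta> ^ j" using D \<beta> by simp
        thus ?thesis using False by simp
      qed
    qed
    also have "\<dots> = (\<Sum>j \<in> {2..2 * L} \<inter> {..n div 2}. D * real n * \<beta> ^ j)"
      by (rule sum.mono_neutral_cong_right) auto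
    also have "\<dots> \<le> (\<Sum>j = 1..n div 2. D * real n * \<beta> ^ j)"
      using D \<beta> by (intro sum_mono2) auto
    also have "\<dots> = D * real n * (\<Sum>j = 1..n div 2. \<beta> ^ j)"
      by (simp add: sum_distrib_left)
    also have "\<dots> \<le> D * real n * (2 * \<beta> ^ (n div 2))"
      using D by (intro mult_left_mono sum_power_le \<beta>) auto
    also have "\<dots> = 2 * D * (real n * \<beta> ^ (n div 2))" by simp
    also have "\<dots> \<le> 2 * D * (2 * \<beta> ^ n)"
      using D by (intro mult_left_mono of_nat_le_two_times_power \<beta>) auto
    finally show ?thesis
      using first unfolding e_def by (intro norm_triangle_le) linarith
  qed

  have "((\<lambda>n. e n * x ^ n) has_sum ?S) {1..} \<longleftrightarrow> ((\<lambda>n. e n * x ^ n) has_sum ?S) {Suc (2 * L)..}"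
    by (rule has_sum_cong_neutral) (use e0 in \<open>auto simp: not_le less_Suc_eq_le\<close>)
  hence sum2: "((\<lambda>n. e n * x ^ n) has_sum ?S) {Suc (2 * L)..}" using sum1 by simp
  have geo: "((\<lambda>n. 6 * D * r ^ n) has_sum (6 * D * (r ^ Suc (2 * L) / (1 - r)))) {Suc (2 * L)..}"
    using r by (intro has_sum_cmult_right has_sum_geometric_tail) auto
  have "norm ?S \<le> 6 * D * (r ^ Suc (2 * L) / (1 - r))"
  proof (rule norm_infsum_le[OF sum2 geo])
    fix n assume "n \<in> {Suc (2 * L)..}"
    hence "norm (e n) \<le> 6 * D * \<beta> ^ n" by (intro e_le) auto
    hence "norm (e n) * norm x ^ n \<le> 6 * D * \<beta> ^ n * norm x ^ n" by (intro mult_right_mono) auto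
    thus "norm (e n * x ^ n) \<le> 6 * D * r ^ n"
      by (simp add: norm_mult norm_power r_def power_mult_distrib mult_ac)
  qed
  also have "r ^ Suc (2 * L) / (1 - r) \<le> r ^ Suc (2 * L) / (1 / 2)"
    using r by (intro divide_left_mono) auto
  hence "6 * D * (r ^ Suc (2 * L) / (1 - r)) \<le> 6 * D * (r ^ Suc (2 * L) / (1 / 2))"
    using D by (intro mult_left_mono) auto
  also have "\<dots> = 12 * D * (\<beta> * norm x) ^ Suc (2 * L)" by (simp add: r_def)
  finally show ?thesis .
qed

section \<open>The product over primes\<close>

theorem theorem4:
  fixes q P L :: nat and a :: int and F G :: "complex poly" and \<beta> :: real
  assumes "q \<ge> 1" and "coprime a (int q)"
    and "poly G 0 = 1" and "poly F 0 = 0" and "poly (pderiv F) 0 = 0"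
    and "\<beta> \<ge> 2"
    and "\<And>\<rho>. poly G \<rho> = 0 \<Longrightarrow> 1 / norm \<rho> < \<beta>"
    and "\<And>\<rho>. poly (G - F) \<rho> = 0 \<Longrightarrow> 1 / norm \<rho> < \<beta>"
    and "real P \<ge> 2 * \<beta>" and "L \<ge> 2"
  shows "\<exists>I. norm I \<le> 8 * real (max (degree (G - F)) (degree G)) * \<beta>\<^sup>2 * (\<beta> / real P) ^ (2 * L) \<and>
    (\<lambda>p. if prime p \<and> p \<ge> P \<and> [int p = a] (mod int q)
          then 1 - poly F (1 / of_nat p) / poly G (1 / of_nat p) else 1)
      has_prod exp (- (\<Sum>j = 2..2 * L. (wcoeff (G - F) j - wcoeff G j) * Y_sum P (of_nat j) q a L) + I)"
proof -
  note q = assms(1) and a = assms(2) and \<beta> = assms(6)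
  define D where "D = real (max (degree (G - F)) (degree G))"
  have D: "D \<ge> 0" by (simp add: D_def)
  have P: "real P \<ge> 4" "P \<ge> 2" using assms(6,9) by linarith+
  define A where "A = {p. prime p \<and> P \<le> p}"
  define s where "s n = inv_root_power_sum (G - F) n - inv_root_power_sum G n" for n
  define \<Delta> where "\<Delta> j = wcoeff (G - F) j - wcoeff G j" for j
  define \<theta> :: "nat \<Rightarrow> nat \<Rightarrow> complex"
    where "\<theta> p e = of_bool ([int p ^ e = a] (mod int q))" for p e

  have GF0: "poly (G - F) 0 = 1" using assms(3,4) by simp
  have roots: "1 / norm \<rho> \<le> \<beta>" if "H = G - F \<or> H = G" "poly H \<rho> = 0" for H \<rho>
    using that assms(7)[of \<rho>] assms(8)[of \<rho>] by auto
  have degs: "real (degree H) \<le> D" if "H = G - F \<or> H = G" for H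
    using that by (auto simp: D_def)

  have conv: "(\<Sum>d | d dvd n. of_nat d * \<Delta> d) = s n" if "n > 0" for n
    using sum_of_nat_times_wcoeff[OF that]
    by (simp add: \<Delta>_def s_def right_diff_distrib sum_subtractf)
  have "Polynomial.coeff F 1 = 0"
    using assms(5) by (simp add: poly_0_coeff_0 coeff_pderiv)
  hence "s 1 = 0"
    by (simp add: s_def inv_root_power_sum_1[OF GF0] inv_root_power_sum_1[OF assms(3)] del: One_nat_def)
  hence \<Delta>1: "\<Delta> 1 = 0" using conv[of 1] by simp
  have \<Delta>_le: "norm (\<Delta> j) \<le> 4 * D * \<beta> ^ j / real j" if j: "j > 0" for j
  proof -
    have "norm (wcoeff H j) \<le> 2 * D * \<beta> ^ j / real j" if H: "H = G - F \<or> H = G" for H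
    proof -
      have "norm (wcoeff H j) \<le> 2 * real (degree H) * \<beta> ^ j / real j"
        by (rule norm_wcoeff_le[OF roots[OF H] \<beta> j])
      also have "\<dots> \<le> 2 * D * \<beta> ^ j / real j"
        using degs[OF H] \<beta> by (intro divide_right_mono mult_right_mono) auto
      finally show ?thesis .
    qed
    from this[of "G - F"] this[of G] have "norm (\<Delta> j) \<le> 2 * (2 * D * \<beta> ^ j / real j)"
      unfolding \<Delta>_def by (intro norm_triangle_le_diff) simp
    thus ?thesis by simp
  qed
  have s_le: "norm (s n) \<le> 2 * D * \<beta> ^ n" for n
  proof -
    have "norm (inv_root_power_sum H n) \<le> D * \<beta> ^ n" if H: "H = G - F \<or> H = G" for H
    proof -
      have "norm (inv_root_power_sum H n) \<le> real (degree H) * \<beta> ^ n"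
        by (rule norm_inv_root_power_sum_le[OF roots[OF H]])
      also have "\<dots> \<le> D * \<beta> ^ n"
        using degs[OF H] \<beta> by (intro mult_right_mono) auto
      finally show ?thesis .
    qed
    from this[of "G - F"] this[of G] have "norm (s n) \<le> 2 * (D * \<beta> ^ n)"
      unfolding s_def by (intro norm_triangle_le_diff) simp
    thus ?thesis by simp
  qed

  have x_small: "\<beta> * norm (1 / of_nat p :: complex) \<le> 1 / 2" if "p \<in> A" for p
  proof -
    have "2 * \<beta> \<le> real p" "real p > 0" using that assms(9) P by (auto simp: A_def)
    thus ?thesis by (simp add: norm_divide divide_le_eq)
  qed
  have "\<exists>lam. ((\<lambda>n. s n * (1 / of_nat p) ^ n / of_nat n) has_sum - lam) {1..} \<and>
      exp lam = 1 - poly F (1 / of_nat p) / poly G (1 / of_nat p)" if p: "p \<in> A" for p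
  proof -
    define x :: complex where "x = 1 / of_nat p"
    have small: "norm (x / \<rho>) < 1" if "H = G - F \<or> H = G" "poly H \<rho> = 0" for H \<rho>
    proof -
      have "norm (x / \<rho>) = (1 / norm \<rho>) * norm x" by (simp add: norm_divide)
      also have "\<dots> \<le> \<beta> * norm x" by (intro mult_right_mono roots[OF that]) auto
      also have "\<dots> < 1" using x_small[OF p] by (simp add: x_def)
      finally show ?thesis .
    qed
    obtain l1 where l1: "((\<lambda>k. inv_root_power_sum (G - F) k * x ^ k / of_nat k) has_sum - l1) {1..}"
        "exp l1 = poly (G - F) x"
      using poly_eq_exp_inv_root_power_sums[OF GF0, of x] small[of "G - F"] by blast
    obtain l2 where l2: "((\<lambda>k. inv_root_power_sum G k * x ^ k / of_nat k) has_sum - l2) {1..}"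
        "exp l2 = poly G x"
      using poly_eq_exp_inv_root_power_sums[OF assms(3), of x] small[of G] by blast
    have "((\<lambda>k. inv_root_power_sum (G - F) k * x ^ k / of_nat k +
        - (inv_root_power_sum G k * x ^ k / of_nat k)) has_sum (- l1 + - (- l2))) {1..}"
      by (intro has_sum_add l1 has_sum_uminusI l2)
    hence "((\<lambda>n. s n * x ^ n / of_nat n) has_sum - (l1 - l2)) {1..}"
      by (simp add: s_def left_diff_distrib diff_divide_distrib)
    moreover have "poly G x \<noteq> 0" using l2(2) exp_not_eq_zero by metis
    hence "exp (l1 - l2) = 1 - poly F x / poly G x"
      by (simp add: exp_diff l1(2) l2(2) diff_divide_distrib)
    ultimately show ?thesis unfolding x_def by blast
  qed
  then obtain lam where
    lam: "\<And>p. p \<in> A \<Longrightarrow> ((\<lambda>n. s n * (1 / of_nat p) ^ n / of_nat n) has_sum - lam p) {1..}"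
    and exp_lam: "\<And>p. p \<in> A \<Longrightarrow> exp (lam p) = 1 - poly F (1 / of_nat p) / poly G (1 / of_nat p)"
    by metis

  define W where "W p = (\<Sum>j = 2..2 * L. \<Delta> j * truncated_value (\<theta> p) L ((1 / of_nat p) ^ j))" for p
  \<comment> \<open>The logarithm of the factor at \<open>p\<close> plus the contribution of \<open>p\<close> to the sum over \<open>j\<close>; the sum
    over all primes of this error is \<open>I\<close>.\<close>
  define err where "err p = \<theta> p 1 * lam p + W p" for p
  \<comment> \<open>A factor \<open>p ^ 2\<close> is kept for the convergence of the sum over the primes; the remaining
    \<open>2 * L - 1\<close> factors \<open>p\<close> are replaced by \<open>P\<close>.\<close>
  define c where "c = 12 * D * \<beta> ^ Suc (2 * L) / real P ^ (2 * L - 1)"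
  have err_le: "norm (err p) \<le> c * (1 / real p ^ 2)" if p: "p \<in> A" for p
  proof -
    have "norm (err p) \<le> 12 * D * (\<beta> * norm (1 / of_nat p :: complex)) ^ Suc (2 * L)"
      unfolding err_def W_def
      by (rule norm_truncation_error_le[where s = s])
        (use \<beta> x_small[OF p] D \<Delta>1 conv \<Delta>_le s_le lam[OF p] in \<open>simp_all add: \<theta>_def\<close>)
    also have "\<dots> = 12 * D * \<beta> ^ Suc (2 * L) / real p ^ (2 * L + 1)"
      by (simp add: norm_divide power_divide)
    also have "real p ^ (2 * L + 1) = real p ^ (2 * L - 1) * real p ^ 2"
    proof -
      have "2 * L + 1 = (2 * L - 1) + 2" using assms(10) by simp
      thus ?thesis by (metis power_add)
    qed
    also have "12 * D * \<beta> ^ Suc (2 * L) / (real p ^ (2 * L - 1) * real p ^ 2) \<le>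
        12 * D * \<beta> ^ Suc (2 * L) / (real P ^ (2 * L - 1) * real p ^ 2)"
    proof (rule divide_left_mono)
      show "real P ^ (2 * L - 1) * real p ^ 2 \<le> real p ^ (2 * L - 1) * real p ^ 2"
        using p by (intro mult_right_mono power_mono) (auto simp: A_def)
      show "0 \<le> 12 * D * \<beta> ^ Suc (2 * L)" using D \<beta> by simp
      show "0 < real p ^ (2 * L - 1) * real p ^ 2 * (real P ^ (2 * L - 1) * real p ^ 2)"
        using p P by (auto simp: A_def)
    qed
    finally show ?thesis by (simp add: c_def)
  qed
  have sq_sm: "(\<lambda>p. 1 / real p ^ 2) summable_on A"
    by (rule summable_on_subset[OF summable_on_inverse_squares[OF P(2)]]) (auto simp: A_def)
  have sq_le: "(\<Sum>\<^sub>\<infinity>p\<in>A. 1 / real p ^ 2) \<le> 1 / (real P - 1)"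
    by (rule infsum_le_finite_sums[OF sq_sm], rule sum_inverse_squares_le[OF P(2)]) (auto simp: A_def)
  have c_sum: "((\<lambda>p. c * (1 / real p ^ 2)) has_sum (c * (\<Sum>\<^sub>\<infinity>p\<in>A. 1 / real p ^ 2))) A"
    by (intro has_sum_cmult_right has_sum_infsum sq_sm)
  have "err summable_on A"
    by (rule abs_summable_summable,
        rule Infinite_Sum.abs_summable_on_comparison_test'[OF has_sum_imp_summable[OF c_sum] err_le])
  then obtain I where I: "(err has_sum I) A" by (auto simp: summable_on_def)

  have "norm I \<le> c * (\<Sum>\<^sub>\<infinity>p\<in>A. 1 / real p ^ 2)"
    by (rule norm_infsum_le[OF I c_sum err_le])
  also have "\<dots> \<le> c * (1 / (real P - 1))"
    using sq_le D \<beta> by (intro mult_left_mono) (auto simp: c_def)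
  \<comment> \<open>This uses \<open>P \<ge> 4\<close>, which follows from \<open>P \<ge> 2 * \<beta>\<close> and \<open>\<beta> \<ge> 2\<close>.\<close>
  also have "\<dots> \<le> c * (4 / 3 * (1 / real P))"
    using P(1) D \<beta> by (intro mult_left_mono) (auto simp: c_def field_simps)
  also have "\<dots> = 16 * D * \<beta> ^ Suc (2 * L) / (real P ^ (2 * L - 1) * real P)"
    by (simp add: c_def mult_ac)
  also have "real P ^ (2 * L - 1) * real P = real P ^ (2 * L)"
    using assms(10) by (intro power_minus_mult) simp
  also have "16 * D * \<beta> ^ Suc (2 * L) / real P ^ (2 * L) = 8 * D * (2 * \<beta>) * (\<beta> / real P) ^ (2 * L)"
    by (simp add: power_divide)
  also have "\<dots> \<le> 8 * D * \<beta>\<^sup>2 * (\<beta> / real P) ^ (2 * L)"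
    using D \<beta> by (intro mult_right_mono mult_left_mono) (auto simp: power2_eq_square)
  finally have I_le: "norm I \<le> 8 * D * \<beta>\<^sup>2 * (\<beta> / real P) ^ (2 * L)" .

  let ?Y = "\<Sum>j = 2..2 * L. \<Delta> j * Y_sum P (of_nat j) q a L"
  have W_sum: "(W has_sum ?Y) A"
    unfolding W_def
  proof (rule has_sum_sum_family, rule has_sum_cmult_right)
    fix j assume "j \<in> {2..2 * L}"
    hence "j \<ge> 2" by simp
    from has_sum_Y_sum[OF q a P(2) this]
    show "((\<lambda>p. truncated_value (\<theta> p) L ((1 / of_nat p) ^ j)) has_sum Y_sum P (of_nat j) q a L) A"
      unfolding A_def \<theta>_def .
  qed
  have "((\<lambda>p. - W p + err p) has_sum (- ?Y + I)) A"
    by (intro has_sum_add has_sum_uminusI W_sum I)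
  hence "((\<lambda>p. \<theta> p 1 * lam p) has_sum (- ?Y + I)) A" by (simp add: err_def)
  also have "?this \<longleftrightarrow> ((\<lambda>p. if p \<in> A then \<theta> p 1 * lam p else 0) has_sum (- ?Y + I)) UNIV"
    by (rule has_sum_cong_neutral) auto
  finally have "(\<lambda>p. if p \<in> A then \<theta> p 1 * lam p else 0) sums (- ?Y + I)"
    by (rule has_sum_imp_sums)
  hence "(\<lambda>p. exp (if p \<in> A then \<theta> p 1 * lam p else 0)) has_prod exp (- ?Y + I)"
    by (simp add: has_prod_def sums_imp_has_prod_exp)
  also have "(\<lambda>p. exp (if p \<in> A then \<theta> p 1 * lam p else 0)) =
      (\<lambda>p. if prime p \<and> p \<ge> P \<and> [int p = a] (mod int q)
          then 1 - poly F (1 / of_nat p) / poly G (1 / of_nat p) else 1)"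
  proof
    fix p
    show "exp (if p \<in> A then \<theta> p 1 * lam p else 0) =
      (if prime p \<and> p \<ge> P \<and> [int p = a] (mod int q)
          then 1 - poly F (1 / of_nat p) / poly G (1 / of_nat p) else 1)"
    proof (cases "p \<in> A")
      case True
      thus ?thesis using exp_lam[OF True] by (simp add: \<theta>_def A_def)
    qed (auto simp: A_def)
  qed
  finally show ?thesis using I_le unfolding D_def \<Delta>_def by blast
qed

end
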